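(* Let $1\le k\le N$. Consider the Lie algebra $\mathfrak{sp}(N-k+1)\subset\mathfrak{sp}(N)$ generated by the root vectors and Cartan elements with indices in $\{k,\dots,N\}$, and its subalgebra $\mathfrak{sp}(N-k)$ with indices in $\{k+1,\dots,N\}$. Let $U(\mathfrak{sp}(N-k+1))$ carry the primitive coproduct $\Delta$, put $\sigma_{k+k}=\ln(1+E_{k+k})$, $$\mathcal F_{\mathcal E_k}=\Bigl(\prod_{i=k+1}^{N}\exp\bigl\{E_{k-i}\otimes E_{k+i}\,e^{-\frac12\sigma_{k+k}}\bigr\}\Bigr)\exp\{H_{kk}\otimes\sigma_{k+k}\}$$ and $\Delta_{\mathcal E_k}(a)=\mathcal F_{\mathcal E_k}\Delta(a)\mathcal F_{\mathcal E_k}^{-1}$. Let $$s_k=\exp\Bigl\{\Bigl(\sum_{i=k+1}^{N}E_{k-i}E_{k+i}\Bigr)f(E_{k+k})\Bigr\},\qquad f(E_{k+k})=-\frac{\sigma_{k+k}}{2E_{k+k}},$$ and let $\mathcal F_{s_k}=(s_k^{-1}\otimes s_k^{-1})\,\Delta_{\mathcal E_k}(s_k)$ be the corresponding coboundary twist. Then applying $\mathcal F_{s_k}$ after $\mathcal F_{\mathcal E_k}$ produces on the subalgebra $\mathfrak{sp}(N-k)$ the same primitivization of generators as the one obtained by the basis transformation $X\mapsto X^{(k)}$ described in the context. That is, just as $\Delta_{\mathcal E_k}(X^{(k)})=X^{(k)}\otimes1+1\otimes X^{(k)}$ for every generator $X$ of $\mathfrak{sp}(N-k)$, one has for the initial generators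 $$\mathcal F_{s_k}\,\Delta_{\mathcal E_k}(X)\,\mathcal F_{s_k}^{-1}=X\otimes1+1\otimes X\qquad\text{for every generator }X\text{ of }\mathfrak{sp}(N-k).$$
   Context: All algebras are over $\mathbb C$. $\mathfrak{sp}(N)$ denotes the symplectic Lie algebra of rank $N$ (type $C_N$), with roots $\pm e_i\pm e_j$ ($i\ne j$), $\pm2e_i$. For $i<j$, $E_{i\pm j}$ and $F_{i\pm j}$ are the generators for the roots $e_i\pm e_j$ and $-(e_i\pm e_j)$; $E_{i+i}$, $F_{i+i}$ those for $\pm2e_i$; $H_{ii}$ is the Cartan generator dual to $2e_i$. Normalization in $2N\times2N$ matrix units $e_{ab}$: $E_{i-j}=e_{ij}-e_{N+j,N+i}$, $E_{i+j}=e_{i,N+j}+e_{j,N+i}$, $F_{i-j}=e_{ji}-e_{N+i,N+j}$, $F_{i+j}=e_{N+i,j}+e_{N+j,i}$ (the formulas for $E_{i+j},F_{i+j}$ also for $i=j$), $H_{ii}=\frac12(e_{ii}-e_{N+i,N+i})$. Products of generators are taken in the universal enveloping algebra, not as matrix products. Basis transformation: for $k<i\le N$ (one index) and $k<i<j\le N$ (two indices), $E^{(k)}_{i+i}=E_{i+i}-E_{k+i}^2e^{-\sigma_{k+k}}$, $E^{(k)}_{i+j}=E_{i+j}-E_{k+i}E_{k+j}e^{-\sigma_{k+k}}$, $F^{(k)}_{i+i}=F_{i+i}-E_{k-i}^2$, $F^{(k)}_{i+j}=F_{i+j}-E_{k-i}E_{k-j}$, $E^{(k)}_{i-j}=E_{i-j}$,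 $F^{(k)}_{i-j}=F_{i-j}$, $H^{(k)}_{ii}=H_{ii}$. Formal interpretation of infinite series: the symbols $E_{i+j}$ and $F_{i+j}$ ($i\le j$) in all formulas are understood as $\xi$, respectively $\xi^{-1}$, times the corresponding Lie algebra elements ($\xi$ a formal parameter), the $E_{i-j},F_{i-j},H_{ii}$ being unscaled; this preserves all commutation relations. All expressions then lie in $U(\mathfrak{sp}(N))[[\xi]][\xi^{-1}]$ or $(U(\mathfrak{sp}(N))\otimes U(\mathfrak{sp}(N)))[[\xi]][\xi^{-1}]$. The expression $\sigma_{k+k}/E_{k+k}$ denotes the power series $\sum_{n\ge0}\frac{(-1)^n}{n+1}E_{k+k}^n$. *)

theory Defs
  imports
    "HOL-Analysis.Finite_Cartesian_Product"
    "HOL-Library.Poly_Mapping"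
    "HOL-Computational_Algebra.Formal_Laurent_Series"
begin

unbundle no Formal_Power_Series.fps_syntax

section \<open>Complex vector spaces, Lie algebras and associative algebras\<close>

class complex_space = ab_group_add +
  fixes cscale :: "complex \<Rightarrow> 'a \<Rightarrow> 'a"  (infixr \<open>*\<^sub>C\<close> 75)
  assumes cscale_add_right: "c *\<^sub>C (x + y) = c *\<^sub>C x + c *\<^sub>C y"
    and cscale_add_left: "(c + d) *\<^sub>C x = c *\<^sub>C x + d *\<^sub>C x"
    and cscale_cscale: "c *\<^sub>C d *\<^sub>C x = (c * d) *\<^sub>C x"
    and cscale_one: "1 *\<^sub>C x = x"

class complex_lie_algebra = complex_space +
  fixes bracket :: "'a \<Rightarrow> 'a \<Rightarrow> 'a"
  assumes bracket_add_left: "bracket (x + y) z = bracket x z + bracket y z"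
    and bracket_add_right: "bracket x (y + z) = bracket x y + bracket x z"
    and bracket_cscale_left: "bracket (c *\<^sub>C x) y = c *\<^sub>C bracket x y"
    and bracket_cscale_right: "bracket x (c *\<^sub>C y) = c *\<^sub>C bracket x y"
    and bracket_self: "bracket x x = 0"
    and bracket_jacobi:
      "bracket x (bracket y z) + bracket y (bracket z x) + bracket z (bracket x y) = 0"

class complex_alg = complex_space + ring_1 +
  assumes cscale_mult_left: "(c *\<^sub>C x) * y = c *\<^sub>C (x * y)"
    and cscale_mult_right: "x * (c *\<^sub>C y) = c *\<^sub>C (x * y)"

lemma vector_space_cscale: "vector_space ((*\<^sub>C) :: complex \<Rightarrow> 'a::complex_space \<Rightarrow> 'a)"
  by unfold_locales (simp_all add: cscale_add_right cscale_add_left cscale_cscale cscale_one)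

lemma cscale_zero_left [simp]: "0 *\<^sub>C (x::'a::complex_space) = 0"
  by (metis add_cancel_right_right cscale_add_left)

lemma cscale_zero_right [simp]: "c *\<^sub>C (0::'a::complex_space) = 0"
  by (metis add_cancel_right_right cscale_add_right)

instantiation complex :: complex_alg
begin
definition "cscale_complex = ((*) :: complex \<Rightarrow> complex \<Rightarrow> complex)"
instance
  by standard (simp_all add: cscale_complex_def algebra_simps)
end

instantiation fls :: (complex_alg) complex_alg
begin
definition "cscale_fls c (f :: 'a fls) = fls_const (c *\<^sub>C 1) * f"
instance
proof
  fix c d :: complex and x y :: "'a fls"
  show "c *\<^sub>C (x + y) = c *\<^sub>C x + c *\<^sub>C y"
    by (simp add: cscale_fls_def distrib_left)
  show "(c + d) *\<^sub>C x = c *\<^sub>C x + d *\<^sub>C x"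
    by (simp add: cscale_fls_def cscale_add_left flip: fls_plus_const distrib_right)
  show "c *\<^sub>C d *\<^sub>C x = (c * d) *\<^sub>C x"
    by (simp add: cscale_fls_def cscale_mult_left cscale_cscale flip: mult.assoc)
  show "1 *\<^sub>C x = x"
    by (simp add: cscale_fls_def cscale_one)
  show "(c *\<^sub>C x) * y = c *\<^sub>C (x * y)"
    by (simp add: cscale_fls_def mult.assoc)
  have "x * fls_const (c *\<^sub>C 1) = fls_const (c *\<^sub>C 1) * x"
    by (simp add: fls_eq_iff cscale_mult_left cscale_mult_right)
  then show "x * (c *\<^sub>C y) = c *\<^sub>C (x * y)"
    by (simp add: cscale_fls_def flip: mult.assoc)
qed
end

section \<open>Monoid algebras and quotients by two-sided ideals\<close>

inductive_set ideal_gen :: "'a::ring_1 set \<Rightarrow> 'a set" for R where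
  zero: "0 \<in> ideal_gen R"
| gen: "r \<in> R \<Longrightarrow> a * r * b \<in> ideal_gen R"
| add: "x \<in> ideal_gen R \<Longrightarrow> y \<in> ideal_gen R \<Longrightarrow> x + y \<in> ideal_gen R"

lemma ideal_gen_mult_left: "x \<in> ideal_gen R \<Longrightarrow> c * x \<in> ideal_gen R"
proof (induction rule: ideal_gen.induct)
  case (gen r a b)
  then show ?case
    using ideal_gen.gen[of r R "c * a" b] by (simp add: mult.assoc)
qed (auto intro: ideal_gen.intros simp: distrib_left)

lemma ideal_gen_mult_right: "x \<in> ideal_gen R \<Longrightarrow> x * c \<in> ideal_gen R"
proof (induction rule: ideal_gen.induct)
  case (gen r a b)
  then show ?case
    using ideal_gen.gen[of r R a "b * c"] by (simp add: mult.assoc)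
qed (auto intro: ideal_gen.intros simp: distrib_right)

lemma ideal_gen_base: "r \<in> R \<Longrightarrow> r \<in> ideal_gen R"
  using ideal_gen.gen[of r R 1 1] by simp

lemma ideal_gen_uminus: "x \<in> ideal_gen R \<Longrightarrow> - x \<in> ideal_gen R"
  using ideal_gen_mult_left[of x R "-1"] by simp

lemma ideal_gen_diff: "x \<in> ideal_gen R \<Longrightarrow> y \<in> ideal_gen R \<Longrightarrow> x - y \<in> ideal_gen R"
  using ideal_gen.add[of x R "- y"] ideal_gen_uminus by fastforce

lemma ideal_gen_equivp: "equivp (\<lambda>x y. x - y \<in> ideal_gen R)"
proof (rule equivpI)
  show "reflp (\<lambda>x y. x - y \<in> ideal_gen R)"
    by (simp add: reflp_def ideal_gen.zero)
  show "symp (\<lambda>x y. x - y \<in> ideal_gen R)"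
    by (metis (mono_tags, lifting) ideal_gen_uminus minus_diff_eq sympI)
  show "transp (\<lambda>x y. x - y \<in> ideal_gen R)"
  proof (rule transpI)
    fix x y z assume "x - y \<in> ideal_gen R" "y - z \<in> ideal_gen R"
    from ideal_gen.add[OF this] show "x - z \<in> ideal_gen R" by simp
  qed
qed

lemma ideal_gen_cong_add:
  "a - a' \<in> ideal_gen R \<Longrightarrow> b - b' \<in> ideal_gen R \<Longrightarrow> (a + b) - (a' + b') \<in> ideal_gen R"
  using ideal_gen.add[of "a - a'" R "b - b'"] by (simp add: algebra_simps)

lemma ideal_gen_cong_diff:
  "a - a' \<in> ideal_gen R \<Longrightarrow> b - b' \<in> ideal_gen R \<Longrightarrow> (a - b) - (a' - b') \<in> ideal_gen R"
  using ideal_gen_diff[of "a - a'" R "b - b'"] by (simp add: algebra_simps)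

lemma ideal_gen_cong_uminus: "a - a' \<in> ideal_gen R \<Longrightarrow> (- a) - (- a') \<in> ideal_gen R"
  using ideal_gen_uminus[of "a - a'" R] by (simp add: algebra_simps)

lemma ideal_gen_cong_mult:
  assumes "a - a' \<in> ideal_gen R" "b - b' \<in> ideal_gen R"
  shows "a * b - a' * b' \<in> ideal_gen R"
proof -
  have "(a - a') * b + a' * (b - b') \<in> ideal_gen R"
    using assms by (intro ideal_gen.add ideal_gen_mult_left ideal_gen_mult_right)
  then show ?thesis by (simp add: algebra_simps)
qed

definition lin_ext :: "('m \<Rightarrow> 'a::complex_space) \<Rightarrow> ('m \<Rightarrow>\<^sub>0 complex) \<Rightarrow> 'a"
  where "lin_ext g p = (\<Sum>m\<in>Poly_Mapping.keys p. Poly_Mapping.lookup p m *\<^sub>C g m)"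

lemma lin_ext_superset:
  assumes "finite S" "Poly_Mapping.keys p \<subseteq> S"
  shows "lin_ext g p = (\<Sum>m\<in>S. Poly_Mapping.lookup p m *\<^sub>C g m)"
  unfolding lin_ext_def
  by (rule sum.mono_neutral_left) (use assms in \<open>auto simp: in_keys_iff\<close>)

lemma lin_ext_zero [simp]: "lin_ext g 0 = 0"
  by (simp add: lin_ext_def)

lemma lin_ext_single [simp]: "lin_ext g (Poly_Mapping.single m c) = c *\<^sub>C g m"
  by (subst lin_ext_superset[of "{m}"]) auto

lemma lin_ext_add: "lin_ext g (p + q) = lin_ext g p + lin_ext g q"
proof -
  let ?S = "Poly_Mapping.keys p \<union> Poly_Mapping.keys q"
  have "lin_ext g (p + q) = (\<Sum>m\<in>?S. Poly_Mapping.lookup (p + q) m *\<^sub>C g m)"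
    by (rule lin_ext_superset) (auto dest: subsetD[OF keys_add])
  also have "\<dots> = (\<Sum>m\<in>?S. Poly_Mapping.lookup p m *\<^sub>C g m)
      + (\<Sum>m\<in>?S. Poly_Mapping.lookup q m *\<^sub>C g m)"
    by (simp add: lookup_add cscale_add_left sum.distrib)
  also have "\<dots> = lin_ext g p + lin_ext g q"
    by (simp add: lin_ext_superset[of ?S])
  finally show ?thesis .
qed

lemma lin_ext_diff: "lin_ext g (p - q) = lin_ext g p - lin_ext g q"
  by (metis add_diff_cancel diff_add_cancel lin_ext_add)

lemma poly_mapping_single_induct [case_names zero single_add]:
  fixes p :: "'m \<Rightarrow>\<^sub>0 'b::ab_group_add"
  assumes "P 0" "\<And>m c q. P q \<Longrightarrow> P (Poly_Mapping.single m c + q)"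
  shows "P p"
proof (induction p rule: Poly_Mapping.update_induct)
  case (update f a b)
  have "Poly_Mapping.update a b f = Poly_Mapping.single a b + f"
    using update(1)
    by (intro poly_mapping_eqI)
      (auto simp: lookup_update lookup_add lookup_single when_def in_keys_iff)
  with update assms show ?case by simp
qed (rule assms)

lemma lin_ext_mult:
  fixes g :: "'m::monoid_add \<Rightarrow> 'a::complex_alg"
  assumes "\<And>m n. g (m + n) = g m * g n"
  shows "lin_ext g (p * q) = lin_ext g p * lin_ext g q"
proof (induction p rule: poly_mapping_single_induct)
  case (single_add m c p)
  have "lin_ext g (Poly_Mapping.single m c * q) = c *\<^sub>C (g m * lin_ext g q)"
  proof (induction q rule: poly_mapping_single_induct)
    case (single_add n d q)
    then show ?case
      by (simp add: distrib_left lin_ext_add mult_single assms cscale_add_right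
          cscale_mult_right cscale_cscale)
  qed simp
  with single_add show ?case
    by (simp add: distrib_right lin_ext_add cscale_mult_left)
qed simp

lemma single_zero_commute:
  fixes p :: "'m::monoid_add \<Rightarrow>\<^sub>0 complex"
  shows "p * Poly_Mapping.single 0 c = Poly_Mapping.single 0 c * p"
  by (induction p rule: poly_mapping_single_induct)
    (simp_all add: distrib_left distrib_right mult_single mult.commute)

section \<open>The universal enveloping algebra\<close>

datatype 'g word = Word (letters: "'g list")

instantiation word :: (type) monoid_add
begin
definition "0 = Word []"
definition "u + v = Word (letters u @ letters v)"
instance by standard (simp_all add: zero_word_def plus_word_def)
end

text \<open>
  The free associative unital algebra on the set \<open>g\<close> is the monoid algebra of words over \<open>g\<close>.
  Dividing by the linearity relations turns it into the tensor algebra of the vector space \<open>g\<close>.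
\<close>

abbreviation letter :: "'g \<Rightarrow> ('g word \<Rightarrow>\<^sub>0 complex)"
  where "letter x \<equiv> Poly_Mapping.single (Word [x]) 1"

definition uea_relations :: "('g::complex_lie_algebra word \<Rightarrow>\<^sub>0 complex) set" where
  "uea_relations =
     {letter (x + y) - letter x - letter y | x y. True}
   \<union> {letter (c *\<^sub>C x) - Poly_Mapping.single 0 c * letter x | c x. True}
   \<union> {letter x * letter y - letter y * letter x - letter (bracket x y) | x y. True}"

definition uea_eq ::
  "('g::complex_lie_algebra word \<Rightarrow>\<^sub>0 complex) \<Rightarrow> ('g word \<Rightarrow>\<^sub>0 complex) \<Rightarrow> bool"
  where "uea_eq p q \<longleftrightarrow> p - q \<in> ideal_gen uea_relations"

quotient_type (overloaded) 'g uea = "'g::complex_lie_algebra word \<Rightarrow>\<^sub>0 complex" / uea_eq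
  unfolding uea_eq_def by (rule ideal_gen_equivp)

lemma uea_augmentation:
  "p \<in> ideal_gen uea_relations \<Longrightarrow> lin_ext (\<lambda>w. if w = 0 then 1 else 0 :: complex) p = 0"
proof (induction rule: ideal_gen.induct)
  case (gen r a b)
  let ?e = "\<lambda>w :: 'a word. if w = 0 then 1 else 0 :: complex"
  have mult: "?e (u + v) = ?e u * ?e v" for u v
    by (cases u; cases v) (auto simp: zero_word_def plus_word_def)
  from gen have "lin_ext ?e r = 0"
    by (auto simp: uea_relations_def lin_ext_diff mult_single cscale_complex_def
        zero_word_def plus_word_def)
  then show ?case by (simp add: lin_ext_mult[of ?e, OF mult])
qed (simp_all add: lin_ext_add)

instantiation uea :: (complex_lie_algebra) complex_alg
begin

lift_definition zero_uea :: "'a uea" is 0 .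
lift_definition one_uea :: "'a uea" is 1 .
lift_definition plus_uea :: "'a uea \<Rightarrow> 'a uea \<Rightarrow> 'a uea" is "(+)"
  unfolding uea_eq_def by (rule ideal_gen_cong_add)
lift_definition minus_uea :: "'a uea \<Rightarrow> 'a uea \<Rightarrow> 'a uea" is "(-)"
  unfolding uea_eq_def by (rule ideal_gen_cong_diff)
lift_definition uminus_uea :: "'a uea \<Rightarrow> 'a uea" is uminus
  unfolding uea_eq_def by (rule ideal_gen_cong_uminus)
lift_definition times_uea :: "'a uea \<Rightarrow> 'a uea \<Rightarrow> 'a uea" is "(*)"
  unfolding uea_eq_def by (rule ideal_gen_cong_mult)
lift_definition cscale_uea :: "complex \<Rightarrow> 'a uea \<Rightarrow> 'a uea"
  is "\<lambda>c p. Poly_Mapping.single 0 c * p"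
  unfolding uea_eq_def by (rule ideal_gen_cong_mult) (simp_all add: ideal_gen.zero)

instance
proof
  fix a b c :: "'a uea" and s t :: complex
  have refl: "uea_eq p q" if "p = q" for p q :: "'a word \<Rightarrow>\<^sub>0 complex"
    using that by (simp add: uea_eq_def ideal_gen.zero)
  show "a + b + c = a + (b + c)" by transfer (rule refl, simp add: algebra_simps)
  show "a + b = b + a" by transfer (rule refl, simp add: algebra_simps)
  show "0 + a = a" by transfer (rule refl, simp)
  show "- a + a = 0" by transfer (rule refl, simp)
  show "a - b = a + - b" by transfer (rule refl, simp)
  show "a * b * c = a * (b * c)" by transfer (rule refl, simp add: mult.assoc)
  show "1 * a = a" by transfer (rule refl, simp)
  show "a * 1 = a" by transfer (rule refl, simp)
  show "(a + b) * c = a * c + b * c" by transfer (rule refl, simp add: distrib_right)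
  show "a * (b + c) = a * b + a * c" by transfer (rule refl, simp add: distrib_left)
  show "s *\<^sub>C (a + b) = s *\<^sub>C a + s *\<^sub>C b" by transfer (rule refl, simp add: distrib_left)
  show "(s + t) *\<^sub>C a = s *\<^sub>C a + t *\<^sub>C a"
    by transfer (rule refl, simp add: single_add distrib_right)
  show "s *\<^sub>C t *\<^sub>C a = (s * t) *\<^sub>C a"
    by transfer (rule refl, simp add: mult_single flip: mult.assoc)
  show "1 *\<^sub>C a = a" by transfer (rule refl, simp)
  show "(s *\<^sub>C a) * b = s *\<^sub>C (a * b)" by transfer (rule refl, simp add: mult.assoc)
  show "a * (s *\<^sub>C b) = s *\<^sub>C (a * b)"
    by transfer (rule refl, simp add: single_zero_commute flip: mult.assoc)
  show "(0::'a uea) \<noteq> 1"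
  proof transfer
    show "\<not> uea_eq (0 :: 'a word \<Rightarrow>\<^sub>0 complex) 1"
    proof
      assume "uea_eq (0 :: 'a word \<Rightarrow>\<^sub>0 complex) 1"
      then have "1 \<in> ideal_gen (uea_relations :: ('a word \<Rightarrow>\<^sub>0 complex) set)"
        using ideal_gen_uminus by (fastforce simp: uea_eq_def)
      from uea_augmentation[OF this] show False
        by (simp add: cscale_complex_def flip: single_one)
    qed
  qed
qed

end

lift_definition uea_incl :: "'g::complex_lie_algebra \<Rightarrow> 'g uea" is letter .

lemma uea_incl_add: "uea_incl (x + y) = uea_incl x + uea_incl y"
proof (transfer, unfold uea_eq_def)
  fix x y :: 'a
  have "letter (x + y) - letter x - letter y \<in> ideal_gen uea_relations"
    by (rule ideal_gen_base) (auto simp: uea_relations_def)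
  then show "letter (x + y) - (letter x + letter y) \<in> ideal_gen uea_relations"
    by (simp add: algebra_simps)
qed

lemma uea_incl_cscale: "uea_incl (c *\<^sub>C x) = c *\<^sub>C uea_incl x"
  by (transfer, unfold uea_eq_def, rule ideal_gen_base) (auto simp: uea_relations_def)

lemma uea_incl_bracket:
  "uea_incl (bracket x y) = uea_incl x * uea_incl y - uea_incl y * uea_incl x"
proof (transfer, unfold uea_eq_def)
  fix x y :: 'a
  have "letter x * letter y - letter y * letter x - letter (bracket x y)
      \<in> ideal_gen uea_relations"
    by (rule ideal_gen_base) (unfold uea_relations_def, blast)
  from ideal_gen_uminus[OF this]
  show "letter (bracket x y) - (letter x * letter y - letter y * letter x)
      \<in> ideal_gen uea_relations"
    by (simp add: algebra_simps)
qed

section \<open>The tensor product of two associative algebras\<close>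

datatype ('a, 'b) tpair = TPair (tfst: 'a) (tsnd: 'b)

instantiation tpair :: (monoid_mult, monoid_mult) monoid_add
begin
definition "0 = TPair 1 1"
definition "s + t = TPair (tfst s * tfst t) (tsnd s * tsnd t)"
instance by standard (simp_all add: zero_tpair_def plus_tpair_def mult.assoc)
end

text \<open>
  The vector space with basis \<open>A \<times> B\<close> is the monoid algebra for the componentwise product, so
  that \<open>(a \<otimes> b) (a' \<otimes> b') = a a' \<otimes> b b'\<close>.  The bilinearity relations are stable under left and
  right multiplication by basis elements; hence the two-sided ideal generated by them is just
  their linear span.
\<close>

abbreviation tbasis :: "'a \<Rightarrow> 'b \<Rightarrow> (('a, 'b) tpair \<Rightarrow>\<^sub>0 complex)"
  where "tbasis a b \<equiv> Poly_Mapping.single (TPair a b) 1"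

definition tensor_relations :: "(('a::complex_alg, 'b::complex_alg) tpair \<Rightarrow>\<^sub>0 complex) set" where
  "tensor_relations =
     {tbasis (a + a') b - tbasis a b - tbasis a' b | a a' b. True}
   \<union> {tbasis a (b + b') - tbasis a b - tbasis a b' | a b b'. True}
   \<union> {tbasis (c *\<^sub>C a) b - Poly_Mapping.single 0 c * tbasis a b | c a b. True}
   \<union> {tbasis a (c *\<^sub>C b) - Poly_Mapping.single 0 c * tbasis a b | c a b. True}"

definition tensor_eq ::
  "(('a::complex_alg, 'b::complex_alg) tpair \<Rightarrow>\<^sub>0 complex) \<Rightarrow> (('a, 'b) tpair \<Rightarrow>\<^sub>0 complex) \<Rightarrow> bool"
  where "tensor_eq p q \<longleftrightarrow> p - q \<in> ideal_gen tensor_relations"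

quotient_type (overloaded) ('a, 'b) tensor =
    "('a::complex_alg, 'b::complex_alg) tpair \<Rightarrow>\<^sub>0 complex" / tensor_eq
  unfolding tensor_eq_def by (rule ideal_gen_equivp)

lemma tensor_functional:
  fixes phi :: "'a::complex_alg \<Rightarrow> complex" and psi :: "'b::complex_alg \<Rightarrow> complex"
  assumes phi: "\<And>x y. phi (x + y) = phi x + phi y" "\<And>c x. phi (c *\<^sub>C x) = c * phi x"
    and psi: "\<And>x y. psi (x + y) = psi x + psi y" "\<And>c x. psi (c *\<^sub>C x) = c * psi x"
    and p: "p \<in> ideal_gen tensor_relations"
  shows "lin_ext (\<lambda>t. phi (tfst t) * psi (tsnd t)) p = 0"
  using p
proof (induction rule: ideal_gen.induct)
  case (gen r p q)
  let ?L = "lin_ext (\<lambda>t. phi (tfst t) * psi (tsnd t))"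
  have basis: "?L (Poly_Mapping.single s c * r * Poly_Mapping.single t d) = 0" for s t c d
    using gen unfolding tensor_relations_def
    by (elim UnE CollectE exE conjE; hypsubst)
      (simp_all add: algebra_simps mult_single lin_ext_add lin_ext_diff
        plus_tpair_def zero_tpair_def phi psi cscale_complex_def cscale_mult_left
        cscale_mult_right)
  have "?L (Poly_Mapping.single s c * r * q) = 0" for s c
    by (induction q rule: poly_mapping_single_induct)
      (simp_all add: basis distrib_left lin_ext_add)
  then show ?case
    by (induction p rule: poly_mapping_single_induct)
      (simp_all add: distrib_right lin_ext_add)
qed (simp_all add: lin_ext_add)

lemma functional_one_exists:
  obtains phi :: "'a::complex_alg \<Rightarrow> complex"
  where "\<And>x y. phi (x + y) = phi x + phi y" "\<And>c x. phi (c *\<^sub>C x) = c * phi x" "phi 1 = 1"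
proof -
  interpret A: vector_space "(*\<^sub>C) :: complex \<Rightarrow> 'a \<Rightarrow> 'a" by (rule vector_space_cscale)
  interpret B: vector_space "(*) :: complex \<Rightarrow> complex \<Rightarrow> complex"
    by unfold_locales (simp_all add: algebra_simps)
  interpret AB: vector_space_pair "(*\<^sub>C) :: complex \<Rightarrow> 'a \<Rightarrow> 'a" "(*) :: complex \<Rightarrow> complex \<Rightarrow> complex"
    by unfold_locales
  have "A.independent {1}"
    by simp
  from AB.linear_independent_extend[OF this, of "\<lambda>_. 1"]
  obtain g where g: "Vector_Spaces.linear (*\<^sub>C) (*) g" "g (1::'a) = 1" by auto
  interpret g: Vector_Spaces.linear "(*\<^sub>C) :: complex \<Rightarrow> 'a \<Rightarrow> 'a" "(*)" g
    by (rule g(1))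
  show ?thesis
    by (rule that[of g]) (simp_all add: g.add g.scale g(2))
qed

instantiation tensor :: (complex_alg, complex_alg) complex_alg
begin

lift_definition zero_tensor :: "('a, 'b) tensor" is 0 .
lift_definition one_tensor :: "('a, 'b) tensor" is 1 .
lift_definition plus_tensor :: "('a, 'b) tensor \<Rightarrow> ('a, 'b) tensor \<Rightarrow> ('a, 'b) tensor" is "(+)"
  unfolding tensor_eq_def by (rule ideal_gen_cong_add)
lift_definition minus_tensor :: "('a, 'b) tensor \<Rightarrow> ('a, 'b) tensor \<Rightarrow> ('a, 'b) tensor" is "(-)"
  unfolding tensor_eq_def by (rule ideal_gen_cong_diff)
lift_definition uminus_tensor :: "('a, 'b) tensor \<Rightarrow> ('a, 'b) tensor" is uminus
  unfolding tensor_eq_def by (rule ideal_gen_cong_uminus)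
lift_definition times_tensor :: "('a, 'b) tensor \<Rightarrow> ('a, 'b) tensor \<Rightarrow> ('a, 'b) tensor" is "(*)"
  unfolding tensor_eq_def by (rule ideal_gen_cong_mult)
lift_definition cscale_tensor :: "complex \<Rightarrow> ('a, 'b) tensor \<Rightarrow> ('a, 'b) tensor"
  is "\<lambda>c p. Poly_Mapping.single 0 c * p"
  unfolding tensor_eq_def by (rule ideal_gen_cong_mult) (simp_all add: ideal_gen.zero)

instance
proof
  fix a b c :: "('a, 'b) tensor" and s t :: complex
  have refl: "tensor_eq p q" if "p = q" for p q :: "('a, 'b) tpair \<Rightarrow>\<^sub>0 complex"
    using that by (simp add: tensor_eq_def ideal_gen.zero)
  show "a + b + c = a + (b + c)" by transfer (rule refl, simp add: algebra_simps)
  show "a + b = b + a" by transfer (rule refl, simp add: algebra_simps)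
  show "0 + a = a" by transfer (rule refl, simp)
  show "- a + a = 0" by transfer (rule refl, simp)
  show "a - b = a + - b" by transfer (rule refl, simp)
  show "a * b * c = a * (b * c)" by transfer (rule refl, simp add: mult.assoc)
  show "1 * a = a" by transfer (rule refl, simp)
  show "a * 1 = a" by transfer (rule refl, simp)
  show "(a + b) * c = a * c + b * c" by transfer (rule refl, simp add: distrib_right)
  show "a * (b + c) = a * b + a * c" by transfer (rule refl, simp add: distrib_left)
  show "s *\<^sub>C (a + b) = s *\<^sub>C a + s *\<^sub>C b" by transfer (rule refl, simp add: distrib_left)
  show "(s + t) *\<^sub>C a = s *\<^sub>C a + t *\<^sub>C a"
    by transfer (rule refl, simp add: single_add distrib_right)
  show "s *\<^sub>C t *\<^sub>C a = (s * t) *\<^sub>C a"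
    by transfer (rule refl, simp add: mult_single flip: mult.assoc)
  show "1 *\<^sub>C a = a" by transfer (rule refl, simp)
  show "(s *\<^sub>C a) * b = s *\<^sub>C (a * b)" by transfer (rule refl, simp add: mult.assoc)
  show "a * (s *\<^sub>C b) = s *\<^sub>C (a * b)"
    by transfer (rule refl, simp add: single_zero_commute flip: mult.assoc)
  show "(0::('a, 'b) tensor) \<noteq> 1"
  proof transfer
    show "\<not> tensor_eq (0 :: ('a, 'b) tpair \<Rightarrow>\<^sub>0 complex) 1"
    proof
      assume "tensor_eq (0 :: ('a, 'b) tpair \<Rightarrow>\<^sub>0 complex) 1"
      then have one: "1 \<in> ideal_gen (tensor_relations :: (('a, 'b) tpair \<Rightarrow>\<^sub>0 complex) set)"
        using ideal_gen_uminus by (fastforce simp: tensor_eq_def)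
      obtain phi :: "'a \<Rightarrow> complex" where phi:
        "\<And>x y. phi (x + y) = phi x + phi y" "\<And>c x. phi (c *\<^sub>C x) = c * phi x" "phi 1 = 1"
        using functional_one_exists by blast
      obtain psi :: "'b \<Rightarrow> complex" where psi:
        "\<And>x y. psi (x + y) = psi x + psi y" "\<And>c x. psi (c *\<^sub>C x) = c * psi x" "psi 1 = 1"
        using functional_one_exists by blast
      from tensor_functional[OF phi(1,2) psi(1,2) one] show False
        by (simp add: cscale_complex_def zero_tpair_def phi psi flip: single_one)
    qed
  qed
qed

end

lift_definition tensor_pure :: "'a::complex_alg \<Rightarrow> 'b::complex_alg \<Rightarrow> ('a, 'b) tensor" is tbasis .

lemma tensor_pure_add_left: "tensor_pure (a + a') b = tensor_pure a b + tensor_pure a' b"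
proof (transfer, unfold tensor_eq_def)
  fix a a' :: 'a and b :: 'b
  have "tbasis (a + a') b - tbasis a b - tbasis a' b \<in> ideal_gen tensor_relations"
    by (rule ideal_gen_base) (unfold tensor_relations_def, blast)
  then show "tbasis (a + a') b - (tbasis a b + tbasis a' b) \<in> ideal_gen tensor_relations"
    by (simp add: algebra_simps)
qed

lemma tensor_pure_add_right: "tensor_pure a (b + b') = tensor_pure a b + tensor_pure a b'"
proof (transfer, unfold tensor_eq_def)
  fix a :: 'a and b b' :: 'b
  have "tbasis a (b + b') - tbasis a b - tbasis a b' \<in> ideal_gen tensor_relations"
    by (rule ideal_gen_base) (unfold tensor_relations_def, blast)
  then show "tbasis a (b + b') - (tbasis a b + tbasis a b') \<in> ideal_gen tensor_relations"
    by (simp add: algebra_simps)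
qed

lemma tensor_pure_cscale_left: "tensor_pure (c *\<^sub>C a) b = c *\<^sub>C tensor_pure a b"
  by (transfer, unfold tensor_eq_def, rule ideal_gen_base) (unfold tensor_relations_def, blast)

lemma tensor_pure_cscale_right: "tensor_pure a (c *\<^sub>C b) = c *\<^sub>C tensor_pure a b"
  by (transfer, unfold tensor_eq_def, rule ideal_gen_base) (unfold tensor_relations_def, blast)

lemma tensor_pure_mult: "tensor_pure a b * tensor_pure a' b' = tensor_pure (a * a') (b * b')"
  by transfer (simp add: mult_single plus_tpair_def tensor_eq_def ideal_gen.zero)

lemma tensor_pure_one: "tensor_pure 1 1 = 1"
  by transfer (simp add: tensor_eq_def ideal_gen.zero flip: single_one zero_tpair_def)

section \<open>The primitive coproduct\<close>

definition prim_incl :: "'g::complex_lie_algebra \<Rightarrow> ('g uea, 'g uea) tensor"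
  where "prim_incl x = tensor_pure (uea_incl x) 1 + tensor_pure 1 (uea_incl x)"

definition word_coprod :: "'g::complex_lie_algebra word \<Rightarrow> ('g uea, 'g uea) tensor"
  where "word_coprod w = prod_list (map prim_incl (letters w))"

lemma word_coprod_add: "word_coprod (u + v) = word_coprod u * word_coprod v"
  by (simp add: word_coprod_def plus_word_def)

lemma tensor_pure_diff_left: "tensor_pure (a - a') b = tensor_pure a b - tensor_pure a' b"
  by (metis add_diff_cancel diff_add_cancel tensor_pure_add_left)

lemma tensor_pure_diff_right: "tensor_pure a (b - b') = tensor_pure a b - tensor_pure a b'"
  by (metis add_diff_cancel diff_add_cancel tensor_pure_add_right)

lemma lin_ext_word_coprod_ideal:
  "p \<in> ideal_gen uea_relations \<Longrightarrow> lin_ext word_coprod p = 0"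
proof (induction rule: ideal_gen.induct)
  case (gen r a b)
  have letter: "lin_ext word_coprod (letter x) = prim_incl x" for x :: 'a
    by (simp add: word_coprod_def cscale_one)
  have const: "lin_ext word_coprod (Poly_Mapping.single 0 c) = c *\<^sub>C 1" for c
    by (simp add: word_coprod_def zero_word_def)
  note m = lin_ext_mult[of word_coprod, OF word_coprod_add]
  from gen have "lin_ext word_coprod r = 0"
    unfolding uea_relations_def
    by (elim UnE CollectE exE conjE; hypsubst)
      (simp_all add: lin_ext_diff lin_ext_add m letter const prim_incl_def uea_incl_add uea_incl_cscale
        uea_incl_bracket tensor_pure_add_left tensor_pure_add_right tensor_pure_diff_left
        tensor_pure_diff_right tensor_pure_cscale_left tensor_pure_cscale_right tensor_pure_mult
        cscale_add_right cscale_mult_left algebra_simps del: lin_ext_single)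
  then show ?case by (simp add: m)
qed (simp_all add: lin_ext_add)

lift_definition coprod :: "'g::complex_lie_algebra uea \<Rightarrow> ('g uea, 'g uea) tensor"
  is "lin_ext word_coprod"
proof -
  fix p q :: "'g word \<Rightarrow>\<^sub>0 complex"
  assume "uea_eq p q"
  then have "lin_ext word_coprod (p - q) = 0"
    by (simp add: uea_eq_def lin_ext_word_coprod_ideal)
  then show "lin_ext word_coprod p = lin_ext word_coprod q"
    by (simp add: lin_ext_diff)
qed

lemma coprod_incl:
  "coprod (uea_incl x) = tensor_pure (uea_incl x) 1 + tensor_pure 1 (uea_incl x)"
  unfolding prim_incl_def[symmetric]
  by transfer (simp add: word_coprod_def cscale_one)

lemma coprod_add: "coprod (a + b) = coprod a + coprod b"
  by transfer (rule lin_ext_add)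

lemma coprod_mult: "coprod (a * b) = coprod a * coprod b"
  by transfer (rule lin_ext_mult, rule word_coprod_add)

lemma coprod_one: "coprod 1 = 1"
  by transfer (simp add: word_coprod_def zero_word_def cscale_one flip: single_one)

lemma coprod_cscale: "coprod (c *\<^sub>C a) = c *\<^sub>C coprod a"
  by transfer (simp add: lin_ext_mult[of word_coprod, OF word_coprod_add] cscale_mult_left
      word_coprod_def zero_word_def)

section \<open>Formal Laurent series\<close>

definition fls_map :: "('a::zero \<Rightarrow> 'b::zero) \<Rightarrow> 'a fls \<Rightarrow> 'b fls"
  where "fls_map h f = Abs_fls (\<lambda>n. h (fls_nth f n))"

lemma fls_map_nth: "h 0 = 0 \<Longrightarrow> fls_nth (fls_map h f) n = h (fls_nth f n)"
  unfolding fls_map_def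
  by (rule nth_Abs_fls_lower_bound[of "fls_subdegree f"]) simp

text \<open>
  The product of \<open>A\<close> and \<open>B\<close>, viewed as Laurent series in the first and in the second tensor factor:
  the coefficient at \<open>n\<close> is the sum of all \<open>A\<^sub>i \<otimes> B\<^sub>j\<close> with \<open>i + j = n\<close>.
\<close>

definition fls_tensor ::
  "'a::complex_alg fls \<Rightarrow> 'b::complex_alg fls \<Rightarrow> ('a, 'b) tensor fls"  (infixl \<open>\<otimes>\<close> 73)
  where "A \<otimes> B = fls_map (\<lambda>a. tensor_pure a 1) A * fls_map (\<lambda>b. tensor_pure 1 b) B"

definition fls_coprod :: "'g::complex_lie_algebra uea fls \<Rightarrow> ('g uea, 'g uea) tensor fls"
  where "fls_coprod = fls_map coprod"

text \<open>
  The infinite sums below are limits in the metric topology of the type of Laurent series, which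
  is the adic topology of the formal parameter \<^term>\<open>fls_X\<close>.
\<close>

definition fls_exp :: "'a::complex_alg fls \<Rightarrow> 'a fls"
  where "fls_exp x = suminf (\<lambda>n. (1 / fact n) *\<^sub>C x ^ n)"

definition fls_ln1p :: "'a::complex_alg fls \<Rightarrow> 'a fls"
  where "fls_ln1p x = suminf (\<lambda>n. ((-1) ^ n / of_nat (n + 1)) *\<^sub>C x ^ (n + 1))"

definition fls_ln1p_over :: "'a::complex_alg fls \<Rightarrow> 'a fls"
  where "fls_ln1p_over x = suminf (\<lambda>n. ((-1) ^ n / of_nat (n + 1)) *\<^sub>C x ^ n)"

definition mult_inv :: "'a::monoid_mult \<Rightarrow> 'a"
  where "mult_inv x = (THE y. x * y = 1 \<and> y * x = 1)"

section \<open>The symplectic Lie algebra\<close>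

text \<open>
  The rank is the cardinality of the index type \<open>'n\<close>; the indices \<open>i\<close> and \<open>N + i\<close> of
  \<open>2N \<times> 2N\<close> matrices are \<^term>\<open>Inl i\<close> and \<^term>\<open>Inr i\<close>.
\<close>

definition symp_form :: "complex^('n::finite + 'n)^('n + 'n)" where
  "symp_form = (\<chi> a b. case (a, b) of
      (Inl i, Inr j) \<Rightarrow> if i = j then 1 else 0
    | (Inr i, Inl j) \<Rightarrow> if i = j then -1 else 0
    | _ \<Rightarrow> 0)"

typedef 'n sp = "{A :: complex^('n::finite + 'n)^('n + 'n).
    transpose A ** symp_form + symp_form ** A = 0}"
  by (rule exI[of _ 0]) (simp add: matrix_matrix_mult_def transpose_def vec_eq_iff)

setup_lifting type_definition_sp

definition mat_scale :: "complex \<Rightarrow> complex^'m^'n \<Rightarrow> complex^'m^'n"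
  where "mat_scale c A = (\<chi> a b. c * A $ a $ b)"

definition mat_unit :: "'n \<Rightarrow> 'm \<Rightarrow> complex^'m^'n"
  where "mat_unit a b = (\<chi> c d. if c = a \<and> d = b then 1 else 0)"

lemma sum_UNIV_Plus:
  fixes f :: "'n::finite + 'n \<Rightarrow> complex"
  shows "sum f UNIV = (\<Sum>i\<in>UNIV. f (Inl i)) + (\<Sum>i\<in>UNIV. f (Inr i))"
proof -
  have "sum f (range Inl \<union> range Inr) = sum f (range Inl) + sum f (range Inr)"
    by (rule sum.union_disjoint) auto
  then show ?thesis by (simp add: UNIV_sum sum.reindex)
qed

lemma sp_iff:
  fixes A :: "complex^('n::finite + 'n)^('n + 'n)"
  shows "transpose A ** symp_form + symp_form ** A = 0 \<longleftrightarrow>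
    (\<forall>i j. A $ Inr i $ Inr j = - A $ Inl j $ Inl i
         \<and> A $ Inl i $ Inr j = A $ Inl j $ Inr i
         \<and> A $ Inr i $ Inl j = A $ Inr j $ Inl i)"
proof -
  let ?M = "transpose A ** symp_form + symp_form ** A"
  have "?M $ Inl i $ Inl j = - A $ Inr j $ Inl i + A $ Inr i $ Inl j"
    "?M $ Inl i $ Inr j = A $ Inl j $ Inl i + A $ Inr i $ Inr j"
    "?M $ Inr i $ Inl j = - A $ Inr j $ Inr i - A $ Inl i $ Inl j"
    "?M $ Inr i $ Inr j = A $ Inl j $ Inr i - A $ Inl i $ Inr j" for i j
    by (simp_all add: matrix_matrix_mult_def transpose_def symp_form_def sum_UNIV_Plus
        if_distrib[of "\<lambda>x. _ * x"] if_distrib[of "\<lambda>x. x * _"] sum_negf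
        cong: if_cong)
  note M = this
  have e1: "- x + y = 0 \<longleftrightarrow> y = x" and e2: "x + y = 0 \<longleftrightarrow> y = - x"
    and e3: "- x - y = 0 \<longleftrightarrow> x = - y" and e4: "x - y = 0 \<longleftrightarrow> x = y" for x y :: complex
  proof -
    show "x + y = 0 \<longleftrightarrow> y = - x" by (rule add_eq_0_iff)
    have "- x - y = 0 \<longleftrightarrow> - (x + y) = 0" by simp
    also have "\<dots> \<longleftrightarrow> x = - y" by (simp only: neg_equal_0_iff_equal eq_neg_iff_add_eq_0)
    finally show "- x - y = 0 \<longleftrightarrow> x = - y" .
  qed auto
  have c: "(\<forall>i j. - A $ Inr j $ Inl i + A $ Inr i $ Inl j = 0)
      \<longleftrightarrow> (\<forall>i j. A $ Inr i $ Inl j = A $ Inr j $ Inl i)"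
    "(\<forall>i j. A $ Inl j $ Inl i + A $ Inr i $ Inr j = 0)
      \<longleftrightarrow> (\<forall>i j. A $ Inr i $ Inr j = - A $ Inl j $ Inl i)"
    "(\<forall>i j. - A $ Inr j $ Inr i - A $ Inl i $ Inl j = 0)
      \<longleftrightarrow> (\<forall>i j. A $ Inr i $ Inr j = - A $ Inl j $ Inl i)"
    "(\<forall>i j. A $ Inl j $ Inr i - A $ Inl i $ Inr j = 0)
      \<longleftrightarrow> (\<forall>i j. A $ Inl i $ Inr j = A $ Inl j $ Inr i)"
    by (simp only: e1, simp only: e2, subst all_comm, simp only: e3, subst all_comm, simp only: e4)
  have "?M = 0 \<longleftrightarrow> (\<forall>a b. ?M $ a $ b = 0)"
    by (simp only: vec_eq_iff zero_index)
  also have "\<dots> \<longleftrightarrow> (\<forall>i j. ?M $ Inl i $ Inl j = 0) \<and> (\<forall>i j. ?M $ Inl i $ Inr j = 0)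
      \<and> (\<forall>i j. ?M $ Inr i $ Inl j = 0) \<and> (\<forall>i j. ?M $ Inr i $ Inr j = 0)"
    by (simp only: split_sum_all all_conj_distrib conj_assoc)
  also have "\<dots> \<longleftrightarrow> (\<forall>i j. A $ Inr i $ Inr j = - A $ Inl j $ Inl i)
      \<and> (\<forall>i j. A $ Inl i $ Inr j = A $ Inl j $ Inr i)
      \<and> (\<forall>i j. A $ Inr i $ Inl j = A $ Inr j $ Inl i)"
    unfolding M c by (simp only: conj_ac simp_thms)
  finally show ?thesis by blast
qed

lemma symp_commutator:
  fixes A B J :: "complex^'n::finite^'n"
  assumes "transpose A ** J + J ** A = 0" "transpose B ** J + J ** B = 0"
  shows "transpose (A ** B - B ** A) ** J + J ** (A ** B - B ** A) = 0"
proof -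
  have t: "transpose (X - Y) = transpose X - transpose Y" for X Y :: "complex^'n^'n"
    by (simp add: transpose_def vec_eq_iff)
  have d: "(X - Y) ** Z = X ** Z - Y ** Z" "Z ** (X - Y) = Z ** X - Z ** Y"
    for X Y Z :: "complex^'n^'n"
    by (simp_all add: matrix_matrix_mult_def vec_eq_iff algebra_simps sum_subtractf)
  have n: "(- X) ** Y = - (X ** Y)" "X ** (- Y) = - (X ** Y)" for X Y :: "complex^'n^'n"
    by (simp_all add: matrix_matrix_mult_def vec_eq_iff sum_negf)
  have A: "transpose A ** J = - (J ** A)" and B: "transpose B ** J = - (J ** B)"
    using assms by (simp_all add: eq_neg_iff_add_eq_0)
  have "transpose (A ** B) ** J = J ** B ** A"
  proof -
    have "transpose (A ** B) ** J = transpose B ** (transpose A ** J)"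
      by (simp add: matrix_transpose_mul matrix_mul_assoc)
    also have "\<dots> = - (transpose B ** J ** A)"
      by (simp only: A n matrix_mul_assoc)
    also have "\<dots> = J ** B ** A"
      by (simp only: B n minus_minus)
    finally show ?thesis .
  qed
  moreover have "transpose (B ** A) ** J = J ** A ** B"
  proof -
    have "transpose (B ** A) ** J = transpose A ** (transpose B ** J)"
      by (simp add: matrix_transpose_mul matrix_mul_assoc)
    also have "\<dots> = - (transpose A ** J ** B)"
      by (simp only: B n matrix_mul_assoc)
    also have "\<dots> = J ** A ** B"
      by (simp only: A n minus_minus)
    finally show ?thesis .
  qed
  ultimately show ?thesis
    by (simp add: t d matrix_mul_assoc)
qed

instantiation sp :: (finite) complex_lie_algebra
begin

lift_definition zero_sp :: "'a sp" is 0
  by (subst sp_iff) simp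
lift_definition plus_sp :: "'a sp \<Rightarrow> 'a sp \<Rightarrow> 'a sp" is "(+)"
  by (simp add: sp_iff)
lift_definition minus_sp :: "'a sp \<Rightarrow> 'a sp \<Rightarrow> 'a sp" is "(-)"
  by (simp add: sp_iff)
lift_definition uminus_sp :: "'a sp \<Rightarrow> 'a sp" is uminus
  by (simp add: sp_iff)
lift_definition cscale_sp :: "complex \<Rightarrow> 'a sp \<Rightarrow> 'a sp" is mat_scale
  by (simp add: sp_iff mat_scale_def)
lift_definition bracket_sp :: "'a sp \<Rightarrow> 'a sp \<Rightarrow> 'a sp" is "\<lambda>A B. A ** B - B ** A"
  by (rule symp_commutator)

instance
proof
  fix x y z :: "'a sp" and c d :: complex
  show "x + y + z = x + (y + z)" by transfer (simp add: algebra_simps)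
  show "x + y = y + x" by transfer (simp add: algebra_simps)
  show "0 + x = x" by transfer simp
  show "- x + x = 0" by transfer simp
  show "x - y = x + - y" by transfer simp
  show "c *\<^sub>C (x + y) = c *\<^sub>C x + c *\<^sub>C y"
    by transfer (simp add: mat_scale_def vec_eq_iff algebra_simps)
  show "(c + d) *\<^sub>C x = c *\<^sub>C x + d *\<^sub>C x"
    by transfer (simp add: mat_scale_def vec_eq_iff algebra_simps)
  show "c *\<^sub>C d *\<^sub>C x = (c * d) *\<^sub>C x"
    by transfer (simp add: mat_scale_def vec_eq_iff algebra_simps)
  show "1 *\<^sub>C x = x" by transfer (simp add: mat_scale_def vec_eq_iff)
  show "bracket (x + y) z = bracket x z + bracket y z"
    by transfer (simp add: matrix_matrix_mult_def vec_eq_iff algebra_simps sum.distrib)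
  show "bracket x (y + z) = bracket x y + bracket x z"
    by transfer (simp add: matrix_matrix_mult_def vec_eq_iff algebra_simps sum.distrib)
  show "bracket (c *\<^sub>C x) y = c *\<^sub>C bracket x y"
    by transfer (simp add: mat_scale_def matrix_matrix_mult_def vec_eq_iff algebra_simps
        sum_distrib_left)
  show "bracket x (c *\<^sub>C y) = c *\<^sub>C bracket x y"
    by transfer (simp add: mat_scale_def matrix_matrix_mult_def vec_eq_iff algebra_simps
        sum_distrib_left)
  show "bracket x x = 0" by transfer simp
  have d: "(X - Y) ** Z = X ** Z - Y ** Z" "Z ** (X - Y) = Z ** X - Z ** Y"
    for X Y Z :: "complex^('a + 'a)^('a + 'a)"
    by (simp_all add: matrix_matrix_mult_def vec_eq_iff algebra_simps sum_subtractf)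
  show "bracket x (bracket y z) + bracket y (bracket z x) + bracket z (bracket x y) = 0"
    by transfer (simp add: d matrix_mul_assoc)
qed

end

lift_definition sp_E_minus :: "'n::finite \<Rightarrow> 'n \<Rightarrow> 'n sp"
  is "\<lambda>i j. mat_unit (Inl i) (Inl j) - mat_unit (Inr j) (Inr i)"
  unfolding sp_iff by (simp add: mat_unit_def conj_commute)

lift_definition sp_E_plus :: "'n::finite \<Rightarrow> 'n \<Rightarrow> 'n sp"
  is "\<lambda>i j. mat_unit (Inl i) (Inr j) + mat_unit (Inl j) (Inr i)"
  unfolding sp_iff by (simp add: mat_unit_def conj_commute)

lift_definition sp_F_minus :: "'n::finite \<Rightarrow> 'n \<Rightarrow> 'n sp"
  is "\<lambda>i j. mat_unit (Inl j) (Inl i) - mat_unit (Inr i) (Inr j)"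
  unfolding sp_iff by (simp add: mat_unit_def conj_commute)

lift_definition sp_F_plus :: "'n::finite \<Rightarrow> 'n \<Rightarrow> 'n sp"
  is "\<lambda>i j. mat_unit (Inr i) (Inl j) + mat_unit (Inr j) (Inl i)"
  unfolding sp_iff by (simp add: mat_unit_def conj_commute)

lift_definition sp_H :: "'n::finite \<Rightarrow> 'n sp"
  is "\<lambda>i. mat_scale (1 / 2) (mat_unit (Inl i) (Inl i) - mat_unit (Inr i) (Inr i))"
  unfolding sp_iff by (simp add: mat_unit_def mat_scale_def conj_commute)

section \<open>Generators in Laurent series over the enveloping algebra\<close>

definition E_minus :: "'n::finite \<Rightarrow> 'n \<Rightarrow> 'n sp uea fls"
  where "E_minus i j = fls_const (uea_incl (sp_E_minus i j))"

definition E_plus :: "'n::finite \<Rightarrow> 'n \<Rightarrow> 'n sp uea fls"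
  where "E_plus i j = fls_X * fls_const (uea_incl (sp_E_plus i j))"

definition F_minus :: "'n::finite \<Rightarrow> 'n \<Rightarrow> 'n sp uea fls"
  where "F_minus i j = fls_const (uea_incl (sp_F_minus i j))"

definition F_plus :: "'n::finite \<Rightarrow> 'n \<Rightarrow> 'n sp uea fls"
  where "F_plus i j = fls_X_inv * fls_const (uea_incl (sp_F_plus i j))"

definition H_diag :: "'n::finite \<Rightarrow> 'n sp uea fls"
  where "H_diag i = fls_const (uea_incl (sp_H i))"

datatype 'n generator =
    GEminus 'n 'n
  | GEplus 'n 'n
  | GFminus 'n 'n
  | GFplus 'n 'n
  | GH 'n

definition generators_above :: "'n::linorder \<Rightarrow> 'n generator set" where
  "generators_above k =
     {GEminus i j | i j. k < i \<and> i < j} \<union> {GFminus i j | i j. k < i \<and> i < j}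
   \<union> {GEplus i j | i j. k < i \<and> i \<le> j} \<union> {GFplus i j | i j. k < i \<and> i \<le> j}
   \<union> {GH i | i. k < i}"

primrec gen_elem :: "'n::finite generator \<Rightarrow> 'n sp uea fls" where
  "gen_elem (GEminus i j) = E_minus i j"
| "gen_elem (GEplus i j) = E_plus i j"
| "gen_elem (GFminus i j) = F_minus i j"
| "gen_elem (GFplus i j) = F_plus i j"
| "gen_elem (GH i) = H_diag i"

section \<open>Twists\<close>

definition sigma :: "'n::finite \<Rightarrow> 'n sp uea fls"
  where "sigma k = fls_ln1p (E_plus k k)"

primrec transformed_gen :: "'n::finite \<Rightarrow> 'n generator \<Rightarrow> 'n sp uea fls" where
  "transformed_gen k (GEminus i j) = E_minus i j"
| "transformed_gen k (GEplus i j) = E_plus i j - E_plus k i * E_plus k j * fls_exp (- sigma k)"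
| "transformed_gen k (GFminus i j) = F_minus i j"
| "transformed_gen k (GFplus i j) = F_plus i j - E_minus k i * E_minus k j"
| "transformed_gen k (GH i) = H_diag i"

definition extended_twist :: "'n::{finite,linorder} \<Rightarrow> ('n sp uea, 'n sp uea) tensor fls" where
  "extended_twist k =
     prod_list (map (\<lambda>i. fls_exp (E_minus k i \<otimes> (E_plus k i * fls_exp (- ((1 / 2) *\<^sub>C sigma k)))))
       (sorted_list_of_set {k<..}))
     * fls_exp (H_diag k \<otimes> sigma k)"

definition twisted_coprod ::
  "'n::{finite,linorder} \<Rightarrow> 'n sp uea fls \<Rightarrow> ('n sp uea, 'n sp uea) tensor fls"
  where "twisted_coprod k a = extended_twist k * fls_coprod a * mult_inv (extended_twist k)"

definition s_elem :: "'n::{finite,linorder} \<Rightarrow> 'n sp uea fls" where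
  "s_elem k = fls_exp ((\<Sum>i\<in>{k<..}. E_minus k i * E_plus k i)
     * (- ((1 / 2) *\<^sub>C fls_ln1p_over (E_plus k k))))"

definition coboundary_twist :: "'n::{finite,linorder} \<Rightarrow> ('n sp uea, 'n sp uea) tensor fls"
  where "coboundary_twist k =
    (mult_inv (s_elem k) \<otimes> mult_inv (s_elem k)) * twisted_coprod k (s_elem k)"


end

theory Submission
  imports Defs
begin

text \<open>
  Put \<open>a i = E\<^sub>k\<^sub>-\<^sub>i\<close>, \<open>b i = E\<^sub>k\<^sub>+\<^sub>i\<close>, \<open>c = E\<^sub>k\<^sub>+\<^sub>k\<close> and \<open>h = H\<^sub>k\<^sub>k\<close>.  The \<open>a i\<close> and \<open>b i\<close> form a
  Heisenberg algebra with \<open>[a i, b i] = c\<close>, on which \<open>h\<close> acts with weights \<open>1/2\<close>, \<open>1/2\<close> and \<open>1\<close>;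
  the other generators act on the span of the \<open>a i\<close> and \<open>b i\<close> and commute with \<open>c\<close> and \<open>h\<close>.

  The product in the extended twist \<open>\<Psi>\<close> is a single exponential \<open>exp T\<close>, since its factors
  commute.  Conjugation by \<open>exp (h \<otimes> \<sigma>)\<close> multiplies \<open>x \<otimes> 1\<close> by a power of \<open>1 \<otimes> e\<^sup>\<sigma>\<close>, and
  \<open>ad T\<close> is nilpotent of order at most three on everything that occurs; so the twisted coproducts
  of the generators are short finite sums, and those of the transformed generators are primitive.

  For the second claim, \<open>ad D\<close> with \<open>D = ln s\<close> maps a generator \<open>E\<^sub>i\<^sub>+\<^sub>j\<close> to a multiple of \<open>b i b j\<close>,
  on which it acts as \<open>- \<sigma>\<close>, and \<open>F\<^sub>i\<^sub>+\<^sub>j\<close> to a multiple of \<open>a i a j\<close>, on which it acts as \<open>\<sigma>\<close>.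
  Summing the exponential series gives \<open>s X s\<^sup>-\<^sup>1 = X\<^sup>(\<^sup>k\<^sup>)\<close>, so that conjugating the twisted coproduct of
  \<open>X\<close> by the coboundary twist \<open>\<Omega>\<close> amounts to conjugating the primitive twisted coproduct of
  \<open>X\<^sup>(\<^sup>k\<^sup>)\<close> by \<open>s\<^sup>-\<^sup>1 \<otimes> s\<^sup>-\<^sup>1\<close>, which gives the primitive element of \<open>X\<close>.
\<close>

section \<open>Adically convergent series\<close>

definition fls_ord_ge :: "int \<Rightarrow> 'a::zero fls \<Rightarrow> bool"
  where "fls_ord_ge m x \<longleftrightarrow> (\<forall>n<m. fls_nth x n = 0)"

lemma fls_ord_ge_mono: "fls_ord_ge m x \<Longrightarrow> n \<le> m \<Longrightarrow> fls_ord_ge n x"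
  by (auto simp: fls_ord_ge_def)

lemma fls_ord_ge_0 [simp]: "fls_ord_ge m 0"
  by (simp add: fls_ord_ge_def)

lemma fls_ord_ge_add:
  fixes x y :: "'a::group_add fls"
  shows "fls_ord_ge m x \<Longrightarrow> fls_ord_ge m y \<Longrightarrow> fls_ord_ge m (x + y)"
  by (simp add: fls_ord_ge_def)

lemma fls_ord_ge_uminus:
  fixes x :: "'a::group_add fls"
  shows "fls_ord_ge m x \<Longrightarrow> fls_ord_ge m (- x)"
  by (simp add: fls_ord_ge_def)

lemma fls_ord_ge_diff:
  fixes x y :: "'a::group_add fls"
  shows "fls_ord_ge m x \<Longrightarrow> fls_ord_ge m y \<Longrightarrow> fls_ord_ge m (x - y)"
  by (simp add: fls_ord_ge_def)

lemma fls_ord_ge_sum: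
  fixes f :: "'b \<Rightarrow> 'a::ab_group_add fls"
  shows "(\<And>i. i \<in> A \<Longrightarrow> fls_ord_ge m (f i)) \<Longrightarrow> fls_ord_ge m (sum f A)"
  by (induction A rule: infinite_finite_induct) (auto intro: fls_ord_ge_add)

lemma fls_ord_ge_mult:
  fixes x y :: "'a::ring_1 fls"
  assumes "fls_ord_ge m x" "fls_ord_ge n y"
  shows "fls_ord_ge (m + n) (x * y)"
proof (cases "x = 0 \<or> y = 0")
  case False
  with assms have "m \<le> fls_subdegree x" "n \<le> fls_subdegree y"
    by (auto intro!: fls_subdegree_geI simp: fls_ord_ge_def)
  then show ?thesis
    by (auto simp: fls_ord_ge_def intro!: fls_times_nth_eq0)
qed auto

lemma fls_ord_ge_one [simp]: "fls_ord_ge 0 (1 :: 'a::ring_1 fls)"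
  by (simp add: fls_ord_ge_def)

lemma fls_ord_ge_power:
  fixes x :: "'a::ring_1 fls"
  shows "fls_ord_ge 1 x \<Longrightarrow> fls_ord_ge (int n) (x ^ n)"
  by (induction n) (use fls_ord_ge_mult[of 1 x] in auto)

lemma cscale_fls_nth [simp]: "fls_nth (c *\<^sub>C x) n = c *\<^sub>C fls_nth x n"
  by (simp add: cscale_fls_def cscale_mult_left)

lemma fls_ord_ge_cscale: "fls_ord_ge m x \<Longrightarrow> fls_ord_ge m (c *\<^sub>C x)"
  by (simp add: fls_ord_ge_def)

lemma fls_ord_ge_exists: "\<exists>d. fls_ord_ge (- d) x"
  by (rule exI[of _ "- fls_subdegree x"]) (simp add: fls_ord_ge_def)

lemma fls_ord_ge_imp_eq:
  fixes x y :: "'a::group_add fls"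
  assumes "\<And>K. fls_ord_ge (int K - d) (x - y)"
  shows "x = y"
proof (rule fls_eqI)
  fix n
  have "n < int (nat (n + d + 1)) - d" by linarith
  with assms[of "nat (n + d + 1)"] show "fls_nth x n = fls_nth y n"
    by (simp add: fls_ord_ge_def)
qed

lemma dist_fls_le:
  fixes x y :: "'a::group_add fls"
  assumes "fls_ord_ge (int L) (x - y)"
  shows "dist x y \<le> (1 / 2) ^ L"
proof (cases "x = y")
  case False
  then have s: "int L \<le> fls_subdegree (x - y)"
    using assms by (intro fls_subdegree_geI) (auto simp: fls_ord_ge_def)
  then have "L \<le> nat (fls_subdegree (x - y))" by linarith
  then have "(1 / 2 :: real) ^ nat (fls_subdegree (x - y)) \<le> (1 / 2) ^ L"
    by (intro power_decreasing) auto
  with s False show ?thesis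
    by (auto simp: dist_fls_def power_one_over inverse_eq_divide)
qed simp

definition adic_family :: "int \<Rightarrow> (nat \<Rightarrow> 'a::zero fls) \<Rightarrow> bool"
  where "adic_family d u \<longleftrightarrow> (\<forall>n. fls_ord_ge (int n - d) (u n))"

lemma adic_family_suminf:
  fixes u :: "nat \<Rightarrow> 'a::ab_group_add fls"
  assumes u: "adic_family d u"
  shows "fls_ord_ge (int K - d) (suminf u - (\<Sum>n<K. u n))"
proof -
  define S where "S = Abs_fls (\<lambda>m. \<Sum>n<nat (m + d + 1). fls_nth (u n) m)"
  have S_nth: "fls_nth S m = (\<Sum>n<nat (m + d + 1). fls_nth (u n) m)" for m
    unfolding S_def by (rule nth_Abs_fls_lower_bound[of "- d"]) simp
  have nth_sum: "fls_nth (\<Sum>n<K. u n) m = (\<Sum>n<K. fls_nth (u n) m)" for K m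
    by (induction K) simp_all
  have S: "fls_ord_ge (int K - d) (S - (\<Sum>n<K. u n))" for K
    unfolding fls_ord_ge_def
  proof (intro allI impI)
    fix m assume m: "m < int K - d"
    have "(\<Sum>n<nat (m + d + 1). fls_nth (u n) m) = (\<Sum>n<K. fls_nth (u n) m)"
      using m u by (intro sum.mono_neutral_left) (auto simp: adic_family_def fls_ord_ge_def)
    then show "fls_nth (S - (\<Sum>n<K. u n)) m = 0"
      by (simp add: S_nth nth_sum)
  qed
  have "(\<lambda>K. \<Sum>n<K. u n) \<longlonglongrightarrow> S"
  proof (rule metric_LIMSEQ_I)
    fix e :: real assume "e > 0"
    then obtain L where L: "(1 / 2) ^ L < e"
      using real_arch_pow_inv[of e "1 / 2"] by auto
    show "\<exists>no. \<forall>K\<ge>no. dist (\<Sum>n<K. u n) S < e"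
    proof (intro exI allI impI)
      fix K assume "nat (int L + d) \<le> K"
      then have "fls_ord_ge (int L) (S - (\<Sum>n<K. u n))"
        by (intro fls_ord_ge_mono[OF S]) linarith
      then have "dist S (\<Sum>n<K. u n) \<le> (1 / 2) ^ L"
        by (rule dist_fls_le)
      with L show "dist (\<Sum>n<K. u n) S < e"
        by (simp add: dist_commute)
    qed
  qed
  then have "suminf u = S"
    by (intro sums_unique[symmetric]) (simp add: sums_def)
  with S show ?thesis by simp
qed

lemma adic_suminf_eqI:
  fixes u :: "nat \<Rightarrow> 'a::ab_group_add fls"
  assumes u: "adic_family d u" and S: "\<And>K. fls_ord_ge (int K - e) (S - (\<Sum>n<K. u n))"
  shows "suminf u = S"
proof (rule fls_ord_ge_imp_eq)
  fix K
  let ?m = "int K - max d e"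
  have "fls_ord_ge ?m (suminf u - (\<Sum>n<K. u n))" "fls_ord_ge ?m (S - (\<Sum>n<K. u n))"
    by (rule fls_ord_ge_mono[OF adic_family_suminf[OF u]], simp, rule fls_ord_ge_mono[OF S], simp)
  from fls_ord_ge_diff[OF this] show "fls_ord_ge ?m (suminf u - S)"
    by simp
qed

lemma adic_suminf_hom:
  fixes u :: "nat \<Rightarrow> 'a::ab_group_add fls" and h :: "'a fls \<Rightarrow> 'b::ab_group_add fls"
  assumes u: "adic_family d u"
    and h: "\<And>x y. h (x + y) = h x + h y" "\<And>m x. fls_ord_ge m x \<Longrightarrow> fls_ord_ge (m - e) (h x)"
  shows "h (suminf u) = suminf (\<lambda>n. h (u n))"
proof (rule adic_suminf_eqI[symmetric])
  show "adic_family (d + e) (\<lambda>n. h (u n))"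
    using u h(2) by (fastforce simp: adic_family_def algebra_simps)
  have h0: "h 0 = 0" using h(1)[of 0 0] by simp
  have hd: "h (x - y) = h x - h y" for x y
    using h(1)[of "x - y" y] by (simp add: algebra_simps)
  fix K
  have "h (\<Sum>n<K. u n) = (\<Sum>n<K. h (u n))"
    by (induction K) (simp_all add: h0 h)
  then show "fls_ord_ge (int K - (d + e)) (h (suminf u) - (\<Sum>n<K. h (u n)))"
    using h(2)[OF adic_family_suminf[OF u, of K]] by (simp add: hd algebra_simps)
qed

lemma adic_suminf_Suc:
  fixes u :: "nat \<Rightarrow> 'a::ab_group_add fls"
  assumes u: "adic_family d u"
  shows "suminf u = u 0 + suminf (\<lambda>n. u (Suc n))"
proof (rule adic_suminf_eqI[OF u])
  have u': "adic_family (d - 1) (\<lambda>n. u (Suc n))"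
    unfolding adic_family_def
  proof
    fix n
    have "fls_ord_ge (int (Suc n) - d) (u (Suc n))"
      using u by (simp only: adic_family_def)
    then show "fls_ord_ge (int n - (d - 1)) (u (Suc n))"
      by (rule fls_ord_ge_mono) simp
  qed
  fix K
  show "fls_ord_ge (int K - d) (u 0 + suminf (\<lambda>n. u (Suc n)) - (\<Sum>n<K. u n))"
  proof (cases K)
    case 0
    have "fls_ord_ge (- d) (u 0)"
      using u[unfolded adic_family_def, rule_format, of 0] by simp
    moreover have "fls_ord_ge (- d) (suminf (\<lambda>n. u (Suc n)))"
      using adic_family_suminf[OF u', of 0] by (auto intro: fls_ord_ge_mono)
    ultimately show ?thesis
      by (simp add: 0 fls_ord_ge_add)
  next
    case (Suc K')
    then show ?thesis
      using adic_family_suminf[OF u', of K']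
      by (simp add: sum.lessThan_Suc_shift algebra_simps del: sum.lessThan_Suc)
  qed
qed

lemma adic_suminf_Cauchy_product:
  fixes u v :: "nat \<Rightarrow> 'a::ring_1 fls"
  assumes u: "adic_family d u" and v: "adic_family e v"
  shows "suminf (\<lambda>n. \<Sum>i\<le>n. u i * v (n - i)) = suminf u * suminf v"
proof (rule adic_suminf_eqI)
  have uv: "fls_ord_ge (int n - (d + e)) (u i * v j)" if "n \<le> i + j" for n i j
    by (rule fls_ord_ge_mono[OF fls_ord_ge_mult[of "int i - d" _ "int j - e"]])
      (use u v that in \<open>auto simp: adic_family_def\<close>)
  show "adic_family (d + e) (\<lambda>n. \<Sum>i\<le>n. u i * v (n - i))"
    unfolding adic_family_def by (auto intro!: fls_ord_ge_sum uv)
  fix K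
  let ?m = "int K - (d + e)"
  let ?T = "{(i, j). i + j < K}"
  let ?U = "\<Sum>n<K. u n" and ?V = "\<Sum>n<K. v n"
  have sub: "?T \<subseteq> {..<K} \<times> {..<K}" by auto
  have "?U * ?V = (\<Sum>(i,j)\<in>{..<K} \<times> {..<K}. u i * v j)"
    by (simp add: sum_product sum.cartesian_product)
  also have "\<dots> = (\<Sum>(i,j)\<in>{..<K} \<times> {..<K} - ?T. u i * v j) + (\<Sum>(i,j)\<in>?T. u i * v j)"
    using sub by (intro sum.subset_diff) auto
  finally have prod: "?U * ?V = (\<Sum>(i,j)\<in>{..<K} \<times> {..<K} - ?T. u i * v j)
      + (\<Sum>n<K. \<Sum>i\<le>n. u i * v (n - i))"
    by (simp add: sum.triangle_reindex)
  have "fls_ord_ge ?m (\<Sum>(i,j)\<in>{..<K} \<times> {..<K} - ?T. u i * v j)"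
    by (rule fls_ord_ge_sum) (auto intro: uv)
  moreover have "fls_ord_ge ?m ((suminf u - ?U) * suminf v)"
    by (rule fls_ord_ge_mono[OF fls_ord_ge_mult])
      (use adic_family_suminf[OF u, of K] adic_family_suminf[OF v, of 0] in auto)
  moreover have "fls_ord_ge ?m (?U * (suminf v - ?V))"
  proof (rule fls_ord_ge_mono[OF fls_ord_ge_mult])
    show "fls_ord_ge (- d) ?U"
      by (rule fls_ord_ge_sum, rule fls_ord_ge_mono) (use u in \<open>auto simp: adic_family_def\<close>)
    show "fls_ord_ge (int K - e) (suminf v - ?V)"
      by (rule adic_family_suminf[OF v])
  qed simp
  ultimately have "fls_ord_ge ?m ((suminf u - ?U) * suminf v + ?U * (suminf v - ?V)
      + (\<Sum>(i,j)\<in>{..<K} \<times> {..<K} - ?T. u i * v j))"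
    by (intro fls_ord_ge_add)
  also have "(suminf u - ?U) * suminf v + ?U * (suminf v - ?V)
      + (\<Sum>(i,j)\<in>{..<K} \<times> {..<K} - ?T. u i * v j)
    = suminf u * suminf v - (?U * ?V - (\<Sum>(i,j)\<in>{..<K} \<times> {..<K} - ?T. u i * v j))"
    by (simp add: left_diff_distrib right_diff_distrib)
  finally show "fls_ord_ge ?m (suminf u * suminf v - (\<Sum>n<K. \<Sum>i\<le>n. u i * v (n - i)))"
    by (simp add: prod)
qed

section \<open>Evaluation of formal power series\<close>

lemma cscale_sum_right: "c *\<^sub>C sum f A = (\<Sum>i\<in>A. c *\<^sub>C f i)"
  for f :: "'b \<Rightarrow> 'a::complex_space"
  by (induction A rule: infinite_finite_induct) (simp_all add: cscale_add_right)

lemma cscale_sum_left: "sum f A *\<^sub>C x = (\<Sum>i\<in>A. f i *\<^sub>C x)"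
  for x :: "'a::complex_space"
  by (induction A rule: infinite_finite_induct) (simp_all add: cscale_add_left)

lemma cscale_minus_left: "(- c) *\<^sub>C x = - (c *\<^sub>C x)" for x :: "'a::complex_space"
  by (metis add.inverse_unique add.right_inverse cscale_add_left cscale_zero_left)

lemma cscale_minus_right: "c *\<^sub>C (- x) = - (c *\<^sub>C x)" for x :: "'a::complex_space"
  by (metis add.inverse_unique add.right_inverse cscale_add_right cscale_zero_right)

lemma cscale_diff_right: "c *\<^sub>C (x - y) = c *\<^sub>C x - c *\<^sub>C y" for x :: "'a::complex_space"
  using cscale_add_right[of c x "- y"] by (simp add: cscale_minus_right)

lemma cscale_Suc_fact:
  "of_nat (Suc n) *\<^sub>C (1 / fact (Suc n)) *\<^sub>C x = (1 / fact n) *\<^sub>C x" for x :: "'a::complex_space"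
proof -
  have "of_nat (Suc n) * (1 / fact (Suc n)) = (1 / fact n :: complex)"
    by (simp del: of_nat_Suc)
  then show ?thesis by (simp only: cscale_cscale)
qed

lemma cscale_Suc_cancel:
  "(1 / of_nat (Suc n)) *\<^sub>C of_nat (Suc n) *\<^sub>C x = x" for x :: "'a::complex_space"
  by (simp add: cscale_cscale cscale_one del: of_nat_Suc)

definition fps_eval :: "complex fps \<Rightarrow> 'a::complex_alg fls \<Rightarrow> 'a fls"
  where "fps_eval P x = suminf (\<lambda>n. fps_nth P n *\<^sub>C x ^ n)"

lemma fps_eval_family:
  "fls_ord_ge 1 x \<Longrightarrow> adic_family 0 (\<lambda>n. fps_nth P n *\<^sub>C x ^ n)"
  by (simp add: adic_family_def fls_ord_ge_cscale fls_ord_ge_power)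

lemma fps_eval_add:
  assumes "fls_ord_ge 1 x"
  shows "fps_eval (P + Q) x = fps_eval P x + fps_eval Q x"
  unfolding fps_eval_def
proof (rule adic_suminf_eqI)
  fix K
  let ?S = "\<lambda>P. suminf (\<lambda>n. fps_nth P n *\<^sub>C x ^ n)" and ?T = "\<lambda>P. \<Sum>n<K. fps_nth P n *\<^sub>C x ^ n"
  have "?S P + ?S Q - ?T (P + Q) = (?S P - ?T P) + (?S Q - ?T Q)"
    by (simp add: cscale_add_left sum.distrib)
  then show "fls_ord_ge (int K - 0) (?S P + ?S Q - ?T (P + Q))"
    by (simp only:) (intro fls_ord_ge_add adic_family_suminf fps_eval_family assms)
qed (rule fps_eval_family[OF assms])

lemma fps_eval_mult:
  assumes "fls_ord_ge 1 x"
  shows "fps_eval (P * Q) x = fps_eval P x * fps_eval Q x"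
proof -
  have *: "fps_nth (P * Q) n *\<^sub>C x ^ n
      = (\<Sum>i\<le>n. (fps_nth P i *\<^sub>C x ^ i) * (fps_nth Q (n - i) *\<^sub>C x ^ (n - i)))" for n
    by (simp add: fps_mult_nth cscale_sum_left cscale_mult_left cscale_mult_right cscale_cscale
        atMost_atLeast0 mult.commute flip: power_add)
  show ?thesis
    unfolding fps_eval_def *
    by (rule adic_suminf_Cauchy_product[OF fps_eval_family fps_eval_family]) (rule assms)+
qed

lemma fps_eval_const: "fps_eval (fps_const c) x = c *\<^sub>C 1"
proof -
  have "fps_eval (fps_const c) x = (\<Sum>n\<in>{0}. fps_nth (fps_const c) n *\<^sub>C x ^ n)"
    unfolding fps_eval_def by (rule suminf_finite) auto
  then show ?thesis by simp
qed

lemma fps_eval_1 [simp]: "fps_eval 1 x = 1"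
  using fps_eval_const[of 1 x] by (simp add: cscale_one)

lemma fps_eval_X [simp]: "fps_eval fps_X x = x"
proof -
  have "fps_eval fps_X x = (\<Sum>n\<in>{1}. fps_nth fps_X n *\<^sub>C x ^ n)"
    unfolding fps_eval_def by (rule suminf_finite) auto
  then show ?thesis by (simp add: cscale_one)
qed

lemma fps_eval_power:
  assumes "fls_ord_ge 1 x"
  shows "fps_eval (P ^ n) x = fps_eval P x ^ n"
  by (induction n) (simp_all add: fps_eval_mult[OF assms])

lemma fps_eval_diff:
  assumes "fls_ord_ge 1 x"
  shows "fps_eval (P - Q) x = fps_eval P x - fps_eval Q x"
  using fps_eval_add[OF assms, of "P - Q" Q] by (simp add: algebra_simps)

lemma fps_eval_sum:
  assumes "fls_ord_ge 1 x" "finite A"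
  shows "fps_eval (\<Sum>i\<in>A. P i) x = (\<Sum>i\<in>A. fps_eval (P i) x)"
  using assms(2)
proof (induction A rule: finite_induct)
  case empty
  show ?case using fps_eval_const[of 0 x] by simp
qed (simp add: fps_eval_add[OF assms(1)])

lemma fps_eval_ord_ge:
  assumes "fls_ord_ge 1 x" "\<And>n. n < K \<Longrightarrow> fps_nth P n = 0"
  shows "fls_ord_ge (int K) (fps_eval P x)"
  using adic_family_suminf[OF fps_eval_family[OF assms(1)], of K P] assms(2)
  by (simp add: fps_eval_def)

lemma fps_power_nth_below:
  fixes P :: "complex fps"
  assumes "fps_nth P 0 = 0" "m < n"
  shows "fps_nth (P ^ n) m = 0"
  using startsby_zero_power_prefix[OF assms(1)] assms(2) by simp

lemma fps_eval_compose:
  assumes x: "fls_ord_ge 1 x" and P: "fps_nth P 0 = 0"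
  shows "fps_eval Q (fps_eval P x) = fps_eval (Q oo P) x"
  unfolding fps_eval_def[of Q]
proof (rule adic_suminf_eqI)
  have "fls_ord_ge 1 (fps_eval P x)"
    using fps_eval_ord_ge[OF x, of 1 P] P by simp
  then show "adic_family 0 (\<lambda>n. fps_nth Q n *\<^sub>C fps_eval P x ^ n)"
    by (rule fps_eval_family)
  fix K
  let ?R = "\<Sum>n<K. fps_const (fps_nth Q n) * P ^ n"
  have "fps_eval ?R x = (\<Sum>n<K. fps_nth Q n *\<^sub>C fps_eval P x ^ n)"
    by (simp add: fps_eval_sum[OF x] fps_eval_mult[OF x] fps_eval_const fps_eval_power[OF x]
        cscale_mult_left)
  moreover have "fls_ord_ge (int K) (fps_eval ((Q oo P) - ?R) x)"
  proof (rule fps_eval_ord_ge[OF x])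
    fix m assume "m < K"
    then have "(\<Sum>n<K. fps_nth Q n * fps_nth (P ^ n) m) = (\<Sum>n=0..m. fps_nth Q n * fps_nth (P ^ n) m)"
      by (intro sum.mono_neutral_right) (auto simp: fps_power_nth_below[OF P])
    then show "fps_nth ((Q oo P) - ?R) m = 0"
      by (simp add: fps_compose_nth fps_sum_nth)
  qed
  ultimately show "fls_ord_ge (int K - 0)
      (fps_eval (Q oo P) x - (\<Sum>n<K. fps_nth Q n *\<^sub>C fps_eval P x ^ n))"
    by (simp add: fps_eval_diff[OF x])
qed

section \<open>Exponentials and logarithms\<close>

lemma fls_exp_conv_eval: "fls_exp x = fps_eval (fps_exp 1) x"
  by (simp add: fls_exp_def fps_eval_def)

lemma fls_exp_family: "fls_ord_ge 1 x \<Longrightarrow> adic_family 0 (\<lambda>n. (1 / fact n) *\<^sub>C x ^ n)"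
  using fps_eval_family[of x "fps_exp 1"] by simp

lemma fls_ord_ge_exp:
  assumes "fls_ord_ge 1 x"
  shows "fls_ord_ge 0 (fls_exp x)"
  using fps_eval_ord_ge[OF assms, of 0] by (simp add: fls_exp_conv_eval)

lemma fls_exp_0 [simp]: "fls_exp 0 = 1"
proof -
  have "fls_exp (0 :: 'a fls) = (\<Sum>n\<in>{0}. (1 / fact n) *\<^sub>C 0 ^ n)"
    unfolding fls_exp_def by (rule suminf_finite) (auto simp: power_0_left)
  then show ?thesis by (simp add: cscale_one)
qed

text \<open>
  With \<open>S n = (\<Sum>i\<le>n. u i * T ^ (n - i) / (n - i)!)\<close> the recursion for \<open>u\<close> amounts to
  \<open>(n + 1) S (n + 1) = B S n\<close>.  Taking \<open>u n = (ad T) ^ n Y / n!\<close> and \<open>B = T\<close> gives Hadamard's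
  formula, and taking \<open>u n = x ^ n / n!\<close> and \<open>B = x + T\<close> the addition theorem.
\<close>

lemma fls_exp_intertwine:
  fixes B T :: "'a::complex_alg fls"
  assumes B: "fls_ord_ge 1 B" and T: "fls_ord_ge 1 T"
    and rec: "\<And>n. of_nat (Suc n) *\<^sub>C u (Suc n) = B * u n - u n * T"
  shows "(\<exists>d. adic_family d u) \<and> fls_exp B * u 0 = suminf u * fls_exp T"
proof -
  have rec': "u (Suc n) = (1 / of_nat (Suc n)) *\<^sub>C (B * u n - u n * T)" for n
    by (simp only: rec[symmetric] cscale_Suc_cancel)
  obtain d where d: "fls_ord_ge (- d) (u 0)"
    using fls_ord_ge_exists by blast
  have u: "adic_family d u"
    unfolding adic_family_def
  proof
    fix n
    show "fls_ord_ge (int n - d) (u n)"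
    proof (induction n)
      case (Suc n)
      show ?case
        using fls_ord_ge_mult[OF B Suc] fls_ord_ge_mult[OF Suc T]
        by (simp add: rec' fls_ord_ge_cscale fls_ord_ge_diff algebra_simps)
    qed (use d in simp)
  qed
  define v where "v n = (1 / fact n) *\<^sub>C T ^ n" for n :: nat
  have v: "of_nat (Suc n) *\<^sub>C v (Suc n) = T * v n" for n
    unfolding v_def cscale_Suc_fact by (simp add: cscale_mult_right)
  have S: "(\<Sum>i\<le>n. u i * v (n - i)) = ((1 / fact n) *\<^sub>C B ^ n) * u 0" for n
  proof (induction n)
    case 0
    show ?case by (simp add: v_def cscale_one)
  next
    case (Suc n)
    let ?w = "\<lambda>i. u i * v (Suc n - i)"
    have "of_nat (Suc n) *\<^sub>C (\<Sum>i\<le>Suc n. ?w i)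
        = (\<Sum>i\<le>Suc n. of_nat i *\<^sub>C ?w i) + (\<Sum>i\<le>Suc n. of_nat (Suc n - i) *\<^sub>C ?w i)"
    proof -
      have "of_nat (Suc n) *\<^sub>C ?w i = (of_nat i + of_nat (Suc n - i)) *\<^sub>C ?w i" if "i \<le> Suc n" for i
        using that by (simp only: of_nat_add[symmetric] le_add_diff_inverse)
      then have "of_nat (Suc n) *\<^sub>C (\<Sum>i\<le>Suc n. ?w i)
          = (\<Sum>i\<le>Suc n. (of_nat i + of_nat (Suc n - i)) *\<^sub>C ?w i)"
        unfolding cscale_sum_right by (intro sum.cong refl) simp
      then show ?thesis by (simp only: cscale_add_left sum.distrib)
    qed
    also have "(\<Sum>i\<le>Suc n. of_nat i *\<^sub>C ?w i) = (\<Sum>i\<le>n. of_nat (Suc i) *\<^sub>C ?w (Suc i))"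
      by (subst sum.atMost_Suc_shift) simp
    also have "\<dots> = (\<Sum>i\<le>n. (B * u i - u i * T) * v (n - i))"
      by (simp flip: rec cscale_mult_left)
    also have "(\<Sum>i\<le>Suc n. of_nat (Suc n - i) *\<^sub>C ?w i)
        = (\<Sum>i\<le>n. u i * (of_nat (Suc (n - i)) *\<^sub>C v (Suc (n - i))))"
      by (simp add: cscale_mult_right Suc_diff_le add_diff_eq)
    also have "\<dots> = (\<Sum>i\<le>n. u i * (T * v (n - i)))"
      by (simp only: v)
    also have "(\<Sum>i\<le>n. (B * u i - u i * T) * v (n - i)) + (\<Sum>i\<le>n. u i * (T * v (n - i)))
        = B * (\<Sum>i\<le>n. u i * v (n - i))"
      by (simp add: algebra_simps sum_distrib_left flip: sum.distrib)
    also have "\<dots> = of_nat (Suc n) *\<^sub>C (((1 / fact (Suc n)) *\<^sub>C B ^ Suc n) * u 0)"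
      unfolding Suc cscale_mult_left cscale_Suc_fact by (simp add: cscale_mult_right mult.assoc)
    finally have "(1 / of_nat (Suc n)) *\<^sub>C of_nat (Suc n) *\<^sub>C (\<Sum>i\<le>Suc n. ?w i)
        = (1 / of_nat (Suc n)) *\<^sub>C of_nat (Suc n) *\<^sub>C (((1 / fact (Suc n)) *\<^sub>C B ^ Suc n) * u 0)"
      by (rule arg_cong)
    then show ?case
      by (simp only: cscale_Suc_cancel)
  qed
  have "suminf u * fls_exp T = suminf (\<lambda>n. \<Sum>i\<le>n. u i * v (n - i))"
    unfolding fls_exp_def v_def by (rule adic_suminf_Cauchy_product[OF u fls_exp_family[OF T], symmetric])
  also have "\<dots> = suminf (\<lambda>n. ((1 / fact n) *\<^sub>C B ^ n) * u 0)"
    by (simp only: S)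
  also have "\<dots> = fls_exp B * u 0"
    unfolding fls_exp_def
    by (rule adic_suminf_hom[where h="\<lambda>x. x * u 0" and e=d, OF fls_exp_family[OF B], symmetric])
      (use fls_ord_ge_mult[OF _ d] in \<open>simp_all add: distrib_right\<close>)
  finally show ?thesis using u by auto
qed

lemma fls_exp_add:
  fixes x y :: "'a::complex_alg fls"
  assumes x: "fls_ord_ge 1 x" and y: "fls_ord_ge 1 y" and comm: "x * y = y * x"
  shows "fls_exp (x + y) = fls_exp x * fls_exp y"
proof -
  have "x ^ n * y = y * x ^ n" for n
    using comm by (metis power_commuting_commutes)
  then have "of_nat (Suc n) *\<^sub>C (1 / fact (Suc n)) *\<^sub>C x ^ Suc n
      = (x + y) * ((1 / fact n) *\<^sub>C x ^ n) - ((1 / fact n) *\<^sub>C x ^ n) * y" for n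
    unfolding cscale_Suc_fact by (simp add: cscale_mult_left cscale_mult_right distrib_right cscale_add_right)
  from fls_exp_intertwine[OF fls_ord_ge_add[OF x y] y, of "\<lambda>n. (1 / fact n) *\<^sub>C x ^ n", OF this]
  show ?thesis by (simp add: fls_exp_def cscale_one)
qed

lemma fls_exp_minus:
  fixes x :: "'a::complex_alg fls"
  assumes "fls_ord_ge 1 x"
  shows "fls_exp x * fls_exp (- x) = 1" "fls_exp (- x) * fls_exp x = 1"
  using fls_exp_add[OF assms fls_ord_ge_uminus[OF assms]]
    fls_exp_add[OF fls_ord_ge_uminus[OF assms] assms] by simp_all

lemma fls_exp_conjugate_quadratic:
  fixes T Y Z W :: "'a::complex_alg fls"
  assumes T: "fls_ord_ge 1 T" and Y: "T * Y = Y * T + Z" and Z: "T * Z = Z * T + 2 *\<^sub>C W"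
    and W: "T * W = W * T"
  shows "fls_exp T * Y = (Y + Z + W) * fls_exp T"
proof -
  define u where "u n = (if n = 0 then Y else if n = 1 then Z else if n = 2 then W else 0)" for n :: nat
  have "of_nat (Suc n) *\<^sub>C u (Suc n) = T * u n - u n * T" for n
    using Y Z W by (cases "n < 3") (auto simp: u_def less_Suc_eq numeral_3_eq_3 cscale_one)
  from fls_exp_intertwine[OF T T, of u, OF this]
  have "fls_exp T * Y = suminf u * fls_exp T"
    by (simp add: u_def)
  also have "suminf u = (\<Sum>n\<in>{0,1,2}. u n)"
    by (rule suminf_finite) (auto simp: u_def)
  finally show ?thesis
    by (simp add: u_def add.assoc)
qed

definition fps_expm1_over :: "complex fps"
  where "fps_expm1_over = Abs_fps (\<lambda>n. 1 / fact (Suc n))"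

lemma fls_exp_conjugate_geometric:
  fixes D Y w p :: "'a::complex_alg fls"
  assumes D: "fls_ord_ge 1 D" and p: "fls_ord_ge 1 p"
    and Y: "D * Y = Y * D + w" and w: "D * w = w * D + p * w" and Dp: "D * p = p * D"
  shows "fls_exp D * Y = (Y + fps_eval fps_expm1_over p * w) * fls_exp D"
proof -
  define u where "u n = (case n of 0 \<Rightarrow> Y | Suc m \<Rightarrow> (1 / fact (Suc m)) *\<^sub>C (p ^ m * w))" for n
  have pw: "D * (p ^ n * w) - p ^ n * w * D = p ^ Suc n * w" for n
  proof -
    have "D * p ^ n = p ^ n * D" using Dp by (metis power_commuting_commutes)
    then have "D * (p ^ n * w) = p ^ n * (D * w)" by (simp flip: mult.assoc)
    then have "D * (p ^ n * w) = p ^ n * w * D + p ^ n * p * w"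
      by (simp add: w distrib_left mult.assoc)
    then show ?thesis by (simp add: power_commutes)
  qed
  have "of_nat (Suc n) *\<^sub>C u (Suc n) = D * u n - u n * D" for n
  proof (cases n)
    case 0
    then show ?thesis by (simp add: u_def Y cscale_one)
  next
    case (Suc m)
    then show ?thesis
      using pw[of m] unfolding u_def Suc nat.case cscale_Suc_fact
      by (simp only: cscale_mult_left cscale_mult_right cscale_diff_right[symmetric])
  qed
  from fls_exp_intertwine[OF D D, of u, OF this] obtain d where
    d: "adic_family d u" and *: "fls_exp D * Y = suminf u * fls_exp D"
    by (auto simp: u_def)
  obtain e where e: "fls_ord_ge (- e) w" using fls_ord_ge_exists by blast
  have "suminf u = Y + suminf (\<lambda>n. ((1 / fact (Suc n)) *\<^sub>C p ^ n) * w)"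
    using adic_suminf_Suc[OF d] by (simp add: u_def cscale_mult_left del: fact_Suc)
  also have "suminf (\<lambda>n. ((1 / fact (Suc n)) *\<^sub>C p ^ n) * w) = fps_eval fps_expm1_over p * w"
    unfolding fps_eval_def
    by (subst adic_suminf_hom[where h="\<lambda>x. x * w" and e=e, OF fps_eval_family[OF p]])
      (use fls_ord_ge_mult[OF _ e] in \<open>simp_all add: distrib_right fps_expm1_over_def\<close>)
  finally show ?thesis using * by simp
qed

lemma fps_eval_commute:
  assumes x: "fls_ord_ge 1 x" and y: "y * x = x * y"
  shows "y * fps_eval P x = fps_eval P x * y"
proof -
  obtain d where d: "fls_ord_ge (- d) y" using fls_ord_ge_exists by blast
  have "y * x ^ n = x ^ n * y" for n
    using y by (metis power_commuting_commutes)
  then have *: "y * (c *\<^sub>C x ^ n) = (c *\<^sub>C x ^ n) * y" for c n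
    by (simp add: cscale_mult_left cscale_mult_right)
  have "y * fps_eval P x = suminf (\<lambda>n. y * (fps_nth P n *\<^sub>C x ^ n))"
    unfolding fps_eval_def
    by (rule adic_suminf_hom[where h="\<lambda>x. y * x" and e=d, OF fps_eval_family[OF x]])
      (use fls_ord_ge_mult[OF d] in \<open>simp_all add: distrib_left\<close>)
  also have "\<dots> = fps_eval P x * y"
    unfolding fps_eval_def *
    by (rule adic_suminf_hom[where h="\<lambda>x. x * y" and e=d, OF fps_eval_family[OF x], symmetric])
      (use fls_ord_ge_mult[OF _ d] in \<open>simp_all add: distrib_right\<close>)
  finally show ?thesis .
qed

lemma fls_exp_commute:
  "fls_ord_ge 1 x \<Longrightarrow> y * x = x * y \<Longrightarrow> y * fls_exp x = fls_exp x * y"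
  unfolding fls_exp_conv_eval by (rule fps_eval_commute)

lemma fls_exp_hom:
  fixes h :: "'a::complex_alg fls \<Rightarrow> 'b::complex_alg fls"
  assumes x: "fls_ord_ge 1 x"
    and h: "\<And>x y. h (x + y) = h x + h y" "\<And>x y. h (x * y) = h x * h y" "h 1 = 1"
      "\<And>c x. h (c *\<^sub>C x) = c *\<^sub>C h x" "\<And>m x. fls_ord_ge m x \<Longrightarrow> fls_ord_ge m (h x)"
  shows "h (fls_exp x) = fls_exp (h x)"
proof -
  have "h (x ^ n) = h x ^ n" for n
    by (induction n) (simp_all add: h)
  moreover have "h (fls_exp x) = suminf (\<lambda>n. h ((1 / fact n) *\<^sub>C x ^ n))"
    unfolding fls_exp_def
    by (rule adic_suminf_hom[where e=0, OF fls_exp_family[OF x]]) (simp_all add: h)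
  ultimately show ?thesis
    by (simp add: fls_exp_def h)
qed

definition fps_ln1p_over :: "complex fps"
  where "fps_ln1p_over = Abs_fps (\<lambda>n. (-1) ^ n / of_nat (n + 1))"

lemma fps_ln_conv_ln1p_over: "fps_ln 1 = fps_X * fps_ln1p_over"
  by (rule fps_ext) (simp add: fps_ln_nth fps_ln1p_over_def)

lemma fls_ln1p_over_conv_eval: "fls_ln1p_over x = fps_eval fps_ln1p_over x"
  by (simp add: fls_ln1p_over_def fps_eval_def fps_ln1p_over_def)

lemma fls_ln1p_conv_eval:
  assumes "fls_ord_ge 1 x"
  shows "fls_ln1p x = fps_eval (fps_ln 1) x"
  using adic_suminf_Suc[OF fps_eval_family[OF assms], of "fps_ln 1"]
  by (simp add: fls_ln1p_def fps_eval_def fps_ln_nth)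

lemma fls_ord_ge_ln1p:
  assumes "fls_ord_ge 1 x"
  shows "fls_ord_ge 1 (fls_ln1p x)"
  using fps_eval_ord_ge[OF assms, of 1 "fps_ln 1"] by (simp add: fls_ln1p_conv_eval[OF assms])

lemma fls_ln1p_conv_over:
  assumes "fls_ord_ge 1 x"
  shows "fls_ln1p x = x * fls_ln1p_over x"
  by (simp add: fls_ln1p_conv_eval[OF assms] fls_ln1p_over_conv_eval fps_ln_conv_ln1p_over
      fps_eval_mult[OF assms])

lemma fps_expm1_over_mult_X: "fps_expm1_over * fps_X = fps_exp 1 - 1"
proof (rule fps_ext)
  fix n
  show "fps_nth (fps_expm1_over * fps_X) n = fps_nth (fps_exp 1 - 1) n"
    by (cases n) (simp_all add: fps_expm1_over_def distrib_right)
qed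

lemma fps_expm1_over_compose_ln: "(fps_expm1_over oo fps_ln 1) * fps_ln1p_over = 1"
proof -
  have "((fps_expm1_over oo fps_ln 1) * fps_ln1p_over) * fps_X
      = (fps_expm1_over oo fps_ln 1) * (fps_X oo fps_ln 1)"
    by (simp add: fps_ln_conv_ln1p_over mult_ac)
  also have "\<dots> = (fps_exp 1 - 1) oo fps_ln 1"
    unfolding fps_expm1_over_mult_X[symmetric] by (subst fps_compose_mult_distrib) simp_all
  also have "\<dots> = 1 * fps_X"
    by (simp add: fps_ln_fps_exp_inv fps_inv_right)
  finally show ?thesis
    by (metis fps_X_neq_zero mult_right_cancel)
qed

lemma fps_expm1_over_compose_uminus: "fps_expm1_over oo (- fps_X) = fps_exp (- 1) * fps_expm1_over"
proof -
  have e: "fps_exp 1 oo (- fps_X) = fps_exp (- 1 :: complex)"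
    using fps_exp_compose_linear[of 1 "- 1 :: complex"]
    by (simp flip: fps_const_neg)
  have "(fps_expm1_over oo (- fps_X)) * fps_X
      = - ((fps_expm1_over oo (- fps_X)) * (fps_X oo (- fps_X)))"
    by simp
  also have "\<dots> = - ((fps_exp 1 - 1) oo (- fps_X))"
    unfolding fps_expm1_over_mult_X[symmetric] by (subst fps_compose_mult_distrib) simp_all
  also have "\<dots> = 1 - fps_exp (- 1)"
    by (simp add: fps_compose_sub_distrib e)
  also have "\<dots> = fps_exp (- 1) * (fps_exp 1 - 1)"
    using fps_exp_add_mult[of "- 1" "1 :: complex"] by (simp add: right_diff_distrib)
  also have "\<dots> = (fps_exp (- 1) * fps_expm1_over) * fps_X"
    by (simp add: fps_expm1_over_mult_X mult.assoc)
  finally show ?thesis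
    by (metis fps_X_neq_zero mult_right_cancel)
qed

lemma fls_expm1_over_ln1p:
  assumes x: "fls_ord_ge 1 x"
  shows "fps_eval fps_expm1_over (fls_ln1p x) * fls_ln1p_over x = 1"
  by (simp add: fls_ln1p_conv_eval[OF x] fls_ln1p_over_conv_eval fps_eval_compose[OF x]
      fps_expm1_over_compose_ln flip: fps_eval_mult[OF x])

lemma fls_exp_ln1p:
  assumes x: "fls_ord_ge 1 x"
  shows "fls_exp (fls_ln1p x) = 1 + x"
proof -
  have "(fps_expm1_over oo fps_ln 1) * fps_ln 1 = fps_X"
    using arg_cong[OF fps_expm1_over_compose_ln, of "\<lambda>P. P * fps_X"]
    by (simp add: fps_ln_conv_ln1p_over mult_ac)
  moreover have "(fps_expm1_over oo fps_ln 1) * fps_ln 1 = (fps_expm1_over * fps_X) oo fps_ln 1"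
    by (simp add: fps_compose_mult_distrib)
  ultimately have "(fps_exp 1 oo fps_ln 1) - 1 = (fps_X :: complex fps)"
    by (simp add: fps_expm1_over_mult_X fps_compose_sub_distrib)
  then have "fps_exp 1 oo fps_ln 1 = 1 + (fps_X :: complex fps)"
    by (simp only: diff_eq_eq add.commute)
  then show ?thesis
    by (simp add: fls_exp_conv_eval fls_ln1p_conv_eval[OF x] fps_eval_compose[OF x]
        fps_eval_add[OF x])
qed

lemma fls_expm1_over_uminus_ln1p:
  assumes x: "fls_ord_ge 1 x"
  shows "fps_eval fps_expm1_over (- fls_ln1p x) * fls_ln1p_over x = fls_exp (- fls_ln1p x)"
proof -
  let ?s = "fls_ln1p x"
  note s = fls_ord_ge_ln1p[OF x]
  have m: "fps_eval (- fps_X) ?s = - ?s"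
    using fps_eval_diff[OF s, of 0 fps_X] fps_eval_const[of 0 ?s] by simp
  have e: "fps_eval (fps_exp (- 1)) ?s = fls_exp (- ?s)"
    using fps_eval_compose[OF s, of "- fps_X" "fps_exp 1"] fps_exp_compose_linear[of 1 "- 1 :: complex"]
    by (simp add: m fls_exp_conv_eval flip: fps_const_neg)
  have "fps_eval fps_expm1_over (- ?s) = fls_exp (- ?s) * fps_eval fps_expm1_over ?s"
    using fps_eval_compose[OF s, of "- fps_X" fps_expm1_over]
    by (simp add: m fps_expm1_over_compose_uminus fps_eval_mult[OF s] e)
  then show ?thesis
    by (simp add: mult.assoc fls_expm1_over_ln1p[OF x])
qed

section \<open>Coefficientwise maps and tensor products\<close>

lemma fls_times_nth_ord_ge:
  fixes x y :: "'a::ring_1 fls"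
  assumes "fls_ord_ge m x" "fls_ord_ge n y"
  shows "fls_nth (x * y) l = (\<Sum>i=m..l - n. fls_nth x i * fls_nth y (l - i))"
proof (cases "x = 0 \<or> y = 0")
  case False
  with assms have s: "m \<le> fls_subdegree x" "n \<le> fls_subdegree y"
    by (auto intro!: fls_subdegree_geI simp: fls_ord_ge_def)
  have "fls_nth x i * fls_nth y (l - i) = 0"
    if "i \<notin> {fls_subdegree x..l - fls_subdegree y}" for i
    using that by (cases "i < fls_subdegree x") (auto simp: fls_eq0_below_subdegree)
  then show ?thesis
    unfolding fls_times_nth(2) using s by (intro sum.mono_neutral_left) auto
qed auto

lemma fls_ord_ge_map:
  "h 0 = 0 \<Longrightarrow> fls_ord_ge m x \<Longrightarrow> fls_ord_ge m (fls_map h x)"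
  by (simp add: fls_ord_ge_def fls_map_nth)

lemma fls_map_add:
  fixes h :: "'a::ab_group_add \<Rightarrow> 'b::ab_group_add"
  assumes "\<And>x y. h (x + y) = h x + h y"
  shows "fls_map h (x + y) = fls_map h x + fls_map h y"
proof -
  have "h 0 = 0" using assms[of 0 0] by simp
  then show ?thesis by (simp add: fls_eq_iff fls_map_nth assms)
qed

lemma fls_map_mult:
  fixes h :: "'a::ring_1 \<Rightarrow> 'b::ring_1"
  assumes h: "\<And>x y. h (x + y) = h x + h y" "\<And>x y. h (x * y) = h x * h y"
  shows "fls_map h (x * y) = fls_map h x * fls_map h y"
proof (rule fls_eqI)
  fix l
  have h0: "h 0 = 0" using h(1)[of 0 0] by simp
  have hs: "h (sum f A) = (\<Sum>i\<in>A. h (f i))" for f :: "int \<Rightarrow> 'a" and A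
    by (induction A rule: infinite_finite_induct) (simp_all add: h h0)
  obtain d e where de: "fls_ord_ge (- d) x" "fls_ord_ge (- e) y"
    using fls_ord_ge_exists by metis
  note de' = fls_ord_ge_map[of h, OF h0 de(1)] fls_ord_ge_map[of h, OF h0 de(2)]
  show "fls_nth (fls_map h (x * y)) l = fls_nth (fls_map h x * fls_map h y) l"
    by (simp add: fls_map_nth h0 fls_times_nth_ord_ge[OF de] fls_times_nth_ord_ge[OF de'] hs h)
qed

lemma fls_map_one: "h 0 = 0 \<Longrightarrow> h 1 = 1 \<Longrightarrow> fls_map h 1 = 1"
  by (simp add: fls_eq_iff fls_map_nth)

lemma fls_map_cscale:
  "h 0 = 0 \<Longrightarrow> (\<And>c x. h (c *\<^sub>C x) = c *\<^sub>C h x) \<Longrightarrow> fls_map h (c *\<^sub>C x) = c *\<^sub>C fls_map h x"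
  by (simp add: fls_eq_iff fls_map_nth)

lemma fls_mult_commuteI:
  fixes x y :: "'a::ring_1 fls"
  assumes "\<And>i j. fls_nth x i * fls_nth y j = fls_nth y j * fls_nth x i"
  shows "x * y = y * x"
proof (rule fls_eqI)
  fix l
  obtain d e where de: "fls_ord_ge (- d) x" "fls_ord_ge (- e) y"
    using fls_ord_ge_exists by metis
  have "fls_nth (x * y) l = (\<Sum>i=- d..l - (- e). fls_nth y (l - i) * fls_nth x i)"
    by (simp add: fls_times_nth_ord_ge[OF de] assms)
  also have "\<dots> = (\<Sum>i=- e..l - (- d). fls_nth y i * fls_nth x (l - i))"
    by (rule sum.reindex_bij_witness[of _ "\<lambda>i. l - i" "\<lambda>i. l - i"]) auto
  finally show "fls_nth (x * y) l = fls_nth (y * x) l"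
    by (simp add: fls_times_nth_ord_ge[OF de(2,1)])
qed

lemma tensor_pure_zero [simp]: "tensor_pure 0 b = 0" "tensor_pure a 0 = 0"
  using tensor_pure_add_left[of 0 0 b] tensor_pure_add_right[of a 0 0] by simp_all

lemma fls_tensor_mult: "(A \<otimes> B) * (C \<otimes> D) = (A * C) \<otimes> (B * D)"
proof -
  let ?l = "fls_map (\<lambda>a. tensor_pure a 1)" and ?r = "fls_map (tensor_pure 1)"
  have m: "?l (A * C) = ?l A * ?l C" "?r (B * D) = ?r B * ?r D"
    by (rule fls_map_mult; simp add: tensor_pure_add_left tensor_pure_add_right tensor_pure_mult)+
  have comm: "?r B * ?l C = ?l C * ?r B"
    by (rule fls_mult_commuteI) (simp add: fls_map_nth tensor_pure_mult)
  have "(A \<otimes> B) * (C \<otimes> D) = ?l A * (?r B * ?l C) * ?r D"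
    by (simp add: fls_tensor_def mult.assoc)
  also have "\<dots> = (A * C) \<otimes> (B * D)"
    unfolding comm by (simp add: fls_tensor_def m mult.assoc)
  finally show ?thesis .
qed

lemma fls_tensor_add_left: "(A + A') \<otimes> B = A \<otimes> B + A' \<otimes> B"
  by (simp add: fls_tensor_def fls_map_add tensor_pure_add_left distrib_right)

lemma fls_tensor_add_right: "A \<otimes> (B + B') = A \<otimes> B + A \<otimes> B'"
  by (simp add: fls_tensor_def fls_map_add tensor_pure_add_right distrib_left)

lemma fls_tensor_zero [simp]: "0 \<otimes> B = 0" "A \<otimes> 0 = 0"
  using fls_tensor_add_left[of 0 0 B] fls_tensor_add_right[of A 0 0] by simp_all

lemma fls_tensor_uminus: "(- A) \<otimes> B = - (A \<otimes> B)" "A \<otimes> (- B) = - (A \<otimes> B)"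
  using fls_tensor_add_left[of A "- A" B] fls_tensor_add_right[of A B "- B"]
  by (simp_all add: add_eq_0_iff)

lemma fls_tensor_diff:
  "(A - A') \<otimes> B = A \<otimes> B - A' \<otimes> B" "A \<otimes> (B - B') = A \<otimes> B - A \<otimes> B'"
  using fls_tensor_add_left[of "A - A'" A' B] fls_tensor_add_right[of A "B - B'" B']
  by (simp_all add: algebra_simps)

lemma fls_tensor_cscale:
  "(c *\<^sub>C A) \<otimes> B = c *\<^sub>C (A \<otimes> B)" "A \<otimes> (c *\<^sub>C B) = c *\<^sub>C (A \<otimes> B)"
  by (simp_all add: fls_tensor_def fls_map_cscale tensor_pure_cscale_left tensor_pure_cscale_right
      cscale_mult_left cscale_mult_right)

lemma fls_tensor_binomials_mult:
  "(A \<otimes> B + C \<otimes> D) * (A' \<otimes> B' + C' \<otimes> D') * (U \<otimes> V)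
    = (A * A' * U) \<otimes> (B * B' * V) + (A * C' * U) \<otimes> (B * D' * V)
      + (C * A' * U) \<otimes> (D * B' * V) + (C * C' * U) \<otimes> (D * D' * V)"
  by (simp add: distrib_left distrib_right fls_tensor_mult add_ac)

lemma fls_tensor_one: "1 \<otimes> 1 = 1"
  by (simp add: fls_tensor_def fls_map_one tensor_pure_one)

lemma fls_ord_ge_tensor: "fls_ord_ge m A \<Longrightarrow> fls_ord_ge n B \<Longrightarrow> fls_ord_ge (m + n) (A \<otimes> B)"
  unfolding fls_tensor_def by (intro fls_ord_ge_mult fls_ord_ge_map) simp_all

lemma fls_tensor_nth:
  "fls_nth (A \<otimes> 1) n = tensor_pure (fls_nth A n) 1"
  "fls_nth (1 \<otimes> B) n = tensor_pure 1 (fls_nth B n)"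
  by (simp_all add: fls_tensor_def fls_map_one fls_map_nth tensor_pure_one)

lemma fls_exp_tensor_right: "fls_ord_ge 1 x \<Longrightarrow> fls_exp (1 \<otimes> x) = 1 \<otimes> fls_exp x"
  by (rule fls_exp_hom[where h="\<lambda>x. 1 \<otimes> x", symmetric])
    (use fls_ord_ge_tensor[of 0 1] in \<open>auto simp: fls_tensor_add_right fls_tensor_mult
      fls_tensor_one fls_tensor_cscale\<close>)

lemma coprod_zero [simp]: "coprod 0 = 0"
  using coprod_add[of 0 0] by simp

lemma fls_coprod_add: "fls_coprod (x + y) = fls_coprod x + fls_coprod y"
  unfolding fls_coprod_def by (rule fls_map_add) (rule coprod_add)

lemma fls_coprod_mult: "fls_coprod (x * y) = fls_coprod x * fls_coprod y"
  unfolding fls_coprod_def by (rule fls_map_mult) (rule coprod_add coprod_mult)+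

lemma fls_coprod_one: "fls_coprod 1 = 1"
  unfolding fls_coprod_def by (simp add: fls_map_one coprod_one)

lemma mult_inv_eqI:
  assumes "x * y = 1" "y * x = 1"
  shows "mult_inv x = y"
  unfolding mult_inv_def
proof (rule the_equality)
  fix z assume "x * z = 1 \<and> z * x = 1"
  then show "z = y" using assms by (metis mult.assoc mult_1_left mult_1_right)
qed (use assms in simp)

section \<open>The twist of a Heisenberg algebra\<close>

lemma sum_two_deltas:
  fixes F :: "'i \<Rightarrow> 'a::monoid_add \<Rightarrow> 'b::comm_monoid_add"
  assumes "finite I" "i \<in> I" "j \<in> I"
    and "\<And>l. l \<in> I \<Longrightarrow> F l 0 = 0"
    and "\<And>l x y. l \<in> I \<Longrightarrow> F l (x + y) = F l x + F l y"
  shows "(\<Sum>l\<in>I. F l ((if l = j then u else 0) + (if l = i then v else 0))) = F j u + F i v"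
proof -
  have "(\<Sum>l\<in>I. F l ((if l = j then u else 0) + (if l = i then v else 0)))
      = (\<Sum>l\<in>I. (if l = j then F l u else 0) + (if l = i then F l v else 0))"
    using assms by (intro sum.cong) auto
  with assms show ?thesis by (simp add: sum.distrib)
qed

locale heisenberg_twist =
  fixes I :: "'i set" and a b :: "'i \<Rightarrow> 'a::complex_alg fls" and c h :: "'a fls"
    and \<Delta> :: "'a fls \<Rightarrow> ('a, 'a) tensor fls"
  assumes finite_I: "finite I"
    and aa: "\<And>i j. i \<in> I \<Longrightarrow> j \<in> I \<Longrightarrow> a i * a j = a j * a i"
    and bb: "\<And>i j. i \<in> I \<Longrightarrow> j \<in> I \<Longrightarrow> b i * b j = b j * b i"
    and ab: "\<And>i j. i \<in> I \<Longrightarrow> j \<in> I \<Longrightarrow> a i * b j = b j * a i + (if i = j then c else 0)"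
    and ac: "\<And>i. i \<in> I \<Longrightarrow> a i * c = c * a i"
    and bc: "\<And>i. i \<in> I \<Longrightarrow> b i * c = c * b i"
    and ha: "\<And>i. i \<in> I \<Longrightarrow> h * a i = a i * h + (1 / 2) *\<^sub>C a i"
    and hb: "\<And>i. i \<in> I \<Longrightarrow> h * b i = b i * h + (1 / 2) *\<^sub>C b i"
    and hc: "h * c = c * h + c"
    and ord_a: "\<And>i. i \<in> I \<Longrightarrow> fls_ord_ge 0 (a i)"
    and ord_b: "\<And>i. i \<in> I \<Longrightarrow> fls_ord_ge 1 (b i)"
    and ord_c: "fls_ord_ge 1 c" and ord_h: "fls_ord_ge 0 h"
    and \<Delta>_add: "\<And>x y. \<Delta> (x + y) = \<Delta> x + \<Delta> y"
    and \<Delta>_mult: "\<And>x y. \<Delta> (x * y) = \<Delta> x * \<Delta> y"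
    and \<Delta>_one: "\<Delta> 1 = 1"
    and \<Delta>_a: "\<And>i. i \<in> I \<Longrightarrow> \<Delta> (a i) = a i \<otimes> 1 + 1 \<otimes> a i"
    and \<Delta>_b: "\<And>i. i \<in> I \<Longrightarrow> \<Delta> (b i) = b i \<otimes> 1 + 1 \<otimes> b i"
    and \<Delta>_c: "\<Delta> c = c \<otimes> 1 + 1 \<otimes> c"
begin

definition "\<sigma> = fls_ln1p c"
definition "g = fls_ln1p_over c"
definition "p = fls_exp ((1 / 2) *\<^sub>C \<sigma>)"
definition "q = fls_exp (- ((1 / 2) *\<^sub>C \<sigma>))"

lemma ord_\<sigma>: "fls_ord_ge 1 \<sigma>"
  unfolding \<sigma>_def by (rule fls_ord_ge_ln1p[OF ord_c])

lemma ord_half_\<sigma>: "fls_ord_ge 1 ((1 / 2) *\<^sub>C \<sigma>)"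
  by (rule fls_ord_ge_cscale[OF ord_\<sigma>])

lemma ord_q: "fls_ord_ge 0 q"
  unfolding q_def by (rule fls_ord_ge_exp[OF fls_ord_ge_uminus[OF ord_half_\<sigma>]])

lemma ord_g: "fls_ord_ge 0 g"
  using fps_eval_ord_ge[OF ord_c, of 0] by (simp add: g_def fls_ln1p_over_conv_eval)

lemma commute_c:
  assumes "y * c = c * y"
  shows "y * \<sigma> = \<sigma> * y" "y * g = g * y" "y * p = p * y" "y * q = q * y"
proof -
  show "y * g = g * y"
    unfolding g_def fls_ln1p_over_conv_eval by (rule fps_eval_commute[OF ord_c assms])
  show s: "y * \<sigma> = \<sigma> * y"
    unfolding \<sigma>_def fls_ln1p_conv_eval[OF ord_c] by (rule fps_eval_commute[OF ord_c assms])
  show "y * p = p * y" "y * q = q * y"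
    unfolding p_def q_def
    by (intro fls_exp_commute ord_half_\<sigma> fls_ord_ge_uminus,
        simp add: s cscale_mult_left cscale_mult_right)+
qed

lemmas commute_a = commute_c[OF ac] and commute_b = commute_c[OF bc]
  and commute_cc = commute_c[OF refl]

lemma \<sigma>_eq: "\<sigma> = c * g"
  unfolding \<sigma>_def g_def by (rule fls_ln1p_conv_over[OF ord_c])

lemma pq: "p * q = 1" and qp: "q * p = 1"
  unfolding p_def q_def by (rule fls_exp_minus[OF ord_half_\<sigma>])+

lemma half_\<sigma>_add: "(1 / 2) *\<^sub>C \<sigma> + (1 / 2) *\<^sub>C \<sigma> = \<sigma>"
  by (simp add: cscale_one flip: cscale_add_left)

lemma pp: "p * p = 1 + c"
proof -
  have "p * p = fls_exp \<sigma>"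
    unfolding p_def using fls_exp_add[OF ord_half_\<sigma> ord_half_\<sigma> refl] by (simp add: half_\<sigma>_add)
  then show ?thesis by (simp add: \<sigma>_def fls_exp_ln1p[OF ord_c])
qed

lemma qq: "q * q = fls_exp (- \<sigma>)"
proof -
  have "- ((1 / 2) *\<^sub>C \<sigma>) + - ((1 / 2) *\<^sub>C \<sigma>) = - \<sigma>"
    by (metis half_\<sigma>_add minus_add_distrib)
  moreover note fls_exp_add[OF ord_half_\<sigma>[THEN fls_ord_ge_uminus] ord_half_\<sigma>[THEN fls_ord_ge_uminus] refl]
  ultimately show ?thesis
    by (simp add: q_def)
qed

lemma one_plus_c_q: "(1 + c) * q = p"
  by (metis pp pq mult.assoc mult_1_right)

lemma one_plus_c_qq: "(1 + c) * (q * q) = 1"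
  by (metis one_plus_c_q pq mult.assoc)

lemma qq_one_plus_c: "(q * q) * (1 + c) = 1"
  by (metis pp pq qp mult.assoc mult_1_left)

lemma p_minus_cq: "p - c * q = q"
  using one_plus_c_q by (simp add: distrib_right algebra_simps)

definition "T = (\<Sum>i\<in>I. a i \<otimes> (b i * q))"
definition "K = fls_exp (h \<otimes> \<sigma>)"
definition "\<Psi> = fls_exp T * K"

lemma ord_bq: "i \<in> I \<Longrightarrow> fls_ord_ge 1 (a i \<otimes> (b i * q))"
  using fls_ord_ge_tensor[OF ord_a fls_ord_ge_mult[OF ord_b ord_q]] by simp

lemma ord_T: "fls_ord_ge 1 T"
  unfolding T_def by (intro fls_ord_ge_sum ord_bq)

lemma ord_h\<sigma>: "fls_ord_ge 1 (h \<otimes> \<sigma>)"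
  using fls_ord_ge_tensor[OF ord_h ord_\<sigma>] by simp

lemma prod_list_exp:
  assumes "set xs \<subseteq> I" "distinct xs"
  shows "prod_list (map (\<lambda>i. fls_exp (a i \<otimes> (b i * q))) xs)
    = fls_exp (\<Sum>i\<in>set xs. a i \<otimes> (b i * q))"
  using assms
proof (induction xs)
  case (Cons i xs)
  let ?t = "\<lambda>i. a i \<otimes> (b i * q)"
  have "?t i * ?t j = ?t j * ?t i" if "j \<in> set xs" for j
  proof -
    have ij: "i \<in> I" "j \<in> I" using Cons that by auto
    have "(b i * q) * (b j * q) = b i * (b j * q) * q"
      using commute_b(4)[OF ij(2)] by (metis mult.assoc)
    also have "\<dots> = b j * (b i * q) * q"
      using bb[OF ij] by (metis mult.assoc)
    also have "\<dots> = (b j * q) * (b i * q)"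
      using commute_b(4)[OF ij(1)] by (metis mult.assoc)
    finally show ?thesis
      by (simp add: fls_tensor_mult aa[OF ij])
  qed
  then have "?t i * (\<Sum>j\<in>set xs. ?t j) = (\<Sum>j\<in>set xs. ?t j) * ?t i"
    by (simp add: sum_distrib_left sum_distrib_right)
  moreover have "fls_ord_ge 1 (\<Sum>j\<in>set xs. ?t j)"
    using Cons by (intro fls_ord_ge_sum ord_bq) auto
  ultimately have "fls_exp (?t i + (\<Sum>j\<in>set xs. ?t j)) = fls_exp (?t i) * fls_exp (\<Sum>j\<in>set xs. ?t j)"
    using Cons by (intro fls_exp_add ord_bq) auto
  with Cons show ?case by simp
qed simp

lemma \<Psi>_inverse:
  "\<Psi> * (fls_exp (- (h \<otimes> \<sigma>)) * fls_exp (- T)) = 1"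
  "(fls_exp (- (h \<otimes> \<sigma>)) * fls_exp (- T)) * \<Psi> = 1"
  using fls_exp_minus[OF ord_T] fls_exp_minus[OF ord_h\<sigma>]
  unfolding \<Psi>_def K_def by (metis mult.assoc mult_1_left)+

lemma T_commutator:
  assumes y: "y * c = c * y"
    and \<alpha>: "\<And>i. i \<in> I \<Longrightarrow> a i * x = x * a i + \<alpha> i"
    and \<beta>: "\<And>i. i \<in> I \<Longrightarrow> b i * y = y * b i + \<beta> i"
  shows "T * (x \<otimes> y) = (x \<otimes> y) * T + (\<Sum>i\<in>I. \<alpha> i \<otimes> (b i * y * q) + (x * a i) \<otimes> (\<beta> i * q))"
proof -
  have "(a i \<otimes> (b i * q)) * (x \<otimes> y) = (x \<otimes> y) * (a i \<otimes> (b i * q))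
      + (\<alpha> i \<otimes> (b i * y * q) + (x * a i) \<otimes> (\<beta> i * q))" if i: "i \<in> I" for i
  proof -
    have "(a i \<otimes> (b i * q)) * (x \<otimes> y) = (a i * x) \<otimes> (b i * y * q)"
      by (simp add: fls_tensor_mult mult.assoc commute_c(4)[OF y])
    also have "\<dots> = (x * a i) \<otimes> (b i * y * q) + \<alpha> i \<otimes> (b i * y * q)"
      by (simp add: \<alpha>[OF i] fls_tensor_add_left)
    also have "(x * a i) \<otimes> (b i * y * q) = (x * a i) \<otimes> (y * (b i * q)) + (x * a i) \<otimes> (\<beta> i * q)"
      by (simp add: \<beta>[OF i] distrib_right fls_tensor_add_right mult.assoc)
    finally show ?thesis
      by (simp add: fls_tensor_mult add_ac)
  qed
  then show ?thesis
    by (simp add: T_def sum_distrib_left sum_distrib_right sum.distrib)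
qed

lemma K_weight:
  assumes x: "h * x = x * h + r *\<^sub>C x"
  shows "K * (x \<otimes> 1) = (x \<otimes> fls_exp (r *\<^sub>C \<sigma>)) * K"
proof -
  have ord: "fls_ord_ge 1 (r *\<^sub>C \<sigma>)" by (rule fls_ord_ge_cscale[OF ord_\<sigma>])
  have ord': "fls_ord_ge 1 (1 \<otimes> (r *\<^sub>C \<sigma>) :: ('a, 'a) tensor fls)"
    using fls_ord_ge_tensor[OF fls_ord_ge_one ord] by simp
  define u where "u n = (if n = 0 then x \<otimes> 1 else 0 :: ('a, 'a) tensor fls)" for n :: nat
  have "(h \<otimes> \<sigma>) * (x \<otimes> 1) = (x \<otimes> 1) * (1 \<otimes> (r *\<^sub>C \<sigma>) + h \<otimes> \<sigma>)"
    by (simp add: distrib_left fls_tensor_mult x fls_tensor_add_left fls_tensor_cscale cscale_mult_right)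
  then have "of_nat (Suc n) *\<^sub>C u (Suc n) = (h \<otimes> \<sigma>) * u n - u n * (1 \<otimes> (r *\<^sub>C \<sigma>) + h \<otimes> \<sigma>)" for n
    by (simp add: u_def)
  from fls_exp_intertwine[OF ord_h\<sigma> fls_ord_ge_add[OF ord' ord_h\<sigma>], of u, OF this]
  have "K * (x \<otimes> 1) = suminf u * fls_exp (1 \<otimes> (r *\<^sub>C \<sigma>) + h \<otimes> \<sigma>)"
    by (simp add: u_def K_def)
  also have "suminf u = (\<Sum>n\<in>{0}. u n)"
    by (rule suminf_finite) (auto simp: u_def)
  also have "fls_exp (1 \<otimes> (r *\<^sub>C \<sigma>) + h \<otimes> \<sigma>) = (1 \<otimes> fls_exp (r *\<^sub>C \<sigma>)) * K"
    unfolding K_def fls_exp_tensor_right[OF ord, symmetric]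
    by (rule fls_exp_add[OF ord' ord_h\<sigma>])
      (simp add: fls_tensor_mult cscale_mult_left cscale_mult_right)
  finally show ?thesis
    by (simp add: u_def fls_tensor_mult flip: mult.assoc)
qed

lemma K_right: "y * c = c * y \<Longrightarrow> K * (1 \<otimes> y) = (1 \<otimes> y) * K"
  unfolding K_def
  by (rule fls_exp_commute[OF ord_h\<sigma>, symmetric]) (simp add: fls_tensor_mult commute_c)

lemma K_primitive:
  assumes "h * x = x * h + r *\<^sub>C x" "x * c = c * x"
  shows "K * (x \<otimes> 1 + 1 \<otimes> x) = (x \<otimes> fls_exp (r *\<^sub>C \<sigma>) + 1 \<otimes> x) * K"
  by (simp add: distrib_left distrib_right K_weight[OF assms(1)] K_right[OF assms(2)])

lemma \<Psi>_trans: "K * x = y * K \<Longrightarrow> fls_exp T * y = z * fls_exp T \<Longrightarrow> \<Psi> * x = z * \<Psi>"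
  unfolding \<Psi>_def by (metis mult.assoc)

lemma T_b:
  assumes "i \<in> I" "y * c = c * y" "\<And>l. l \<in> I \<Longrightarrow> b l * y = y * b l"
  shows "T * (b i \<otimes> y) = (b i \<otimes> y) * T + c \<otimes> (b i * y * q)"
proof -
  have "T * (b i \<otimes> y) = (b i \<otimes> y) * T
      + (\<Sum>l\<in>I. (if l = i then c else 0) \<otimes> (b l * y * q) + (b i * a l) \<otimes> (0 * q))"
    using assms ab by (intro T_commutator) auto
  also have "(\<Sum>l\<in>I. (if l = i then c else 0) \<otimes> (b l * y * q) + (b i * a l) \<otimes> (0 * q))
      = (\<Sum>l\<in>I. if l = i then c \<otimes> (b l * y * q) else 0)"
    by (rule sum.cong) auto
  finally show ?thesis
    using assms finite_I by simp
qed

lemma T_a: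
  assumes i: "i \<in> I" and x: "\<And>l. l \<in> I \<Longrightarrow> a l * x = x * a l"
    and z: "z * c = c * z" "\<And>l. l \<in> I \<Longrightarrow> b l * z = z * b l"
  shows "T * (x \<otimes> (a i * z)) = (x \<otimes> (a i * z)) * T - (x * a i) \<otimes> (c * z * q)"
proof -
  have \<beta>: "b l * (a i * z) = a i * z * b l + (if l = i then - (c * z) else 0)" if "l \<in> I" for l
  proof -
    have "b l * a i = a i * b l + (if l = i then - c else 0)"
      using ab[OF i that] by auto
    then have "b l * (a i * z) = a i * (b l * z) + (if l = i then - (c * z) else 0)"
      by (auto simp: distrib_right left_diff_distrib simp flip: mult.assoc)
    then show ?thesis by (simp add: z(2)[OF that] mult.assoc)
  qed
  have "a i * z * c = c * (a i * z)"
    using ac[OF i] z(1) by (metis mult.assoc)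
  then have "T * (x \<otimes> (a i * z)) = (x \<otimes> (a i * z)) * T
      + (\<Sum>l\<in>I. 0 \<otimes> (b l * (a i * z) * q) + (x * a l) \<otimes> ((if l = i then - (c * z) else 0) * q))"
    using x \<beta> by (intro T_commutator) auto
  also have "(\<Sum>l\<in>I. 0 \<otimes> (b l * (a i * z) * q) + (x * a l) \<otimes> ((if l = i then - (c * z) else 0) * q))
      = (\<Sum>l\<in>I. if l = i then - ((x * a l) \<otimes> (c * z * q)) else 0)"
    by (rule sum.cong) (auto simp: fls_tensor_uminus)
  finally show ?thesis
    using i finite_I by simp
qed

lemma T_commute:
  assumes "y * c = c * y" "\<And>i. i \<in> I \<Longrightarrow> a i * x = x * a i" "\<And>i. i \<in> I \<Longrightarrow> b i * y = y * b i"
  shows "T * (x \<otimes> y) = (x \<otimes> y) * T"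
  using T_commutator[of y x "\<lambda>_. 0" "\<lambda>_. 0"] assms by simp

lemma \<Psi>_a:
  assumes i: "i \<in> I"
  shows "\<Psi> * \<Delta> (a i) = (a i \<otimes> q + 1 \<otimes> a i) * \<Psi>"
proof (rule \<Psi>_trans)
  show "K * \<Delta> (a i) = (a i \<otimes> p + 1 \<otimes> a i) * K"
    unfolding \<Delta>_a[OF i] p_def by (rule K_primitive[OF ha[OF i] ac[OF i]])
  have "fls_exp T * (a i \<otimes> p + 1 \<otimes> a i)
      = (a i \<otimes> p + 1 \<otimes> a i + - (a i \<otimes> (c * q)) + 0) * fls_exp T"
  proof (rule fls_exp_conjugate_quadratic[OF ord_T])
    show "T * (a i \<otimes> p + 1 \<otimes> a i) = (a i \<otimes> p + 1 \<otimes> a i) * T + - (a i \<otimes> (c * q))"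
      using T_commute[of p "a i"] T_a[OF i, of 1 1] aa[OF i] commute_b(3) commute_cc(3)
      by (simp add: distrib_left distrib_right)
    show "T * - (a i \<otimes> (c * q)) = - (a i \<otimes> (c * q)) * T + 2 *\<^sub>C 0"
    proof -
      have "T * (a i \<otimes> (c * q)) = (a i \<otimes> (c * q)) * T"
        using aa[OF i] bc commute_b(4) commute_cc(4)
        by (intro T_commute) (simp_all, (metis mult.assoc)+)
      then show ?thesis by simp
    qed
  qed simp
  also have "a i \<otimes> p + 1 \<otimes> a i + - (a i \<otimes> (c * q)) + 0 = a i \<otimes> (p - c * q) + 1 \<otimes> a i"
    by (simp add: fls_tensor_diff)
  finally show "fls_exp T * (a i \<otimes> p + 1 \<otimes> a i) = (a i \<otimes> q + 1 \<otimes> a i) * fls_exp T"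
    by (simp only: p_minus_cq)
qed

lemma \<Psi>_b:
  assumes i: "i \<in> I"
  shows "\<Psi> * \<Delta> (b i) = (b i \<otimes> p + (1 + c) \<otimes> b i) * \<Psi>"
proof (rule \<Psi>_trans)
  show "K * \<Delta> (b i) = (b i \<otimes> p + 1 \<otimes> b i) * K"
    unfolding \<Delta>_b[OF i] p_def by (rule K_primitive[OF hb[OF i] bc[OF i]])
  have "fls_exp T * (b i \<otimes> p + 1 \<otimes> b i)
      = (b i \<otimes> p + 1 \<otimes> b i + c \<otimes> b i + 0) * fls_exp T"
  proof (rule fls_exp_conjugate_quadratic[OF ord_T])
    show "T * (b i \<otimes> p + 1 \<otimes> b i) = (b i \<otimes> p + 1 \<otimes> b i) * T + c \<otimes> b i"
      using T_commute[of "b i" 1] T_b[OF i, of p] bb[OF _ i] bc[OF i] commute_b(3) commute_cc(3)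
      by (simp add: distrib_left distrib_right mult.assoc pq)
    show "T * (c \<otimes> b i) = (c \<otimes> b i) * T + 2 *\<^sub>C 0"
      using T_commute[of "b i" c] bb[OF _ i] ac bc[OF i] by simp
  qed simp
  then show "fls_exp T * (b i \<otimes> p + 1 \<otimes> b i) = (b i \<otimes> p + (1 + c) \<otimes> b i) * fls_exp T"
    by (simp add: fls_tensor_add_left add.assoc)
qed

lemma \<Psi>_one_plus_c: "\<Psi> * \<Delta> (1 + c) = ((1 + c) \<otimes> (1 + c)) * \<Psi>"
proof (rule \<Psi>_trans)
  have *: "(1 + c) \<otimes> (1 + c) = 1 + (c \<otimes> fls_exp (1 *\<^sub>C \<sigma>) + 1 \<otimes> c)"
    by (simp add: cscale_one \<sigma>_def fls_exp_ln1p[OF ord_c] fls_tensor_add_left fls_tensor_add_right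
        fls_tensor_one add_ac)
  have "K * (c \<otimes> 1 + 1 \<otimes> c) = (c \<otimes> fls_exp (1 *\<^sub>C \<sigma>) + 1 \<otimes> c) * K"
    by (rule K_primitive) (simp_all add: hc cscale_one)
  then show "K * \<Delta> (1 + c) = ((1 + c) \<otimes> (1 + c)) * K"
    by (simp add: * \<Delta>_add \<Delta>_one \<Delta>_c distrib_left distrib_right)
  show "fls_exp T * ((1 + c) \<otimes> (1 + c)) = ((1 + c) \<otimes> (1 + c)) * fls_exp T"
    by (rule fls_exp_commute[OF ord_T, symmetric], rule T_commute[symmetric])
      (simp_all add: distrib_left distrib_right ac bc)
qed

definition "\<Psi>' = fls_exp (- (h \<otimes> \<sigma>)) * fls_exp (- T)"

definition "twist x = \<Psi> * \<Delta> x * \<Psi>'"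

lemma twist_eqI: "\<Psi> * \<Delta> x = y * \<Psi> \<Longrightarrow> twist x = y"
  unfolding twist_def \<Psi>'_def by (simp only: mult.assoc[of y] \<Psi>_inverse mult_1_right)

lemma twist_add: "twist (x + y) = twist x + twist y"
  by (simp add: twist_def \<Delta>_add distrib_left distrib_right)

lemma twist_diff: "twist (x - y) = twist x - twist y"
  using twist_add[of "x - y" y] by (simp add: algebra_simps)

lemma twist_one: "twist 1 = 1"
  by (rule twist_eqI) (simp add: \<Delta>_one)

lemma twist_mult: "twist (x * y) = twist x * twist y"
proof -
  have "twist x * twist y = \<Psi> * \<Delta> x * (\<Psi>' * \<Psi>) * \<Delta> y * \<Psi>'"
    by (simp add: twist_def mult.assoc)
  then show ?thesis
    by (simp add: \<Psi>'_def \<Psi>_inverse) (simp add: twist_def \<Psi>'_def \<Delta>_mult mult.assoc)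
qed

lemmas twist_a = twist_eqI[OF \<Psi>_a] and twist_b = twist_eqI[OF \<Psi>_b]

lemma twist_qq: "twist (q * q) = (q * q) \<otimes> (q * q)"
proof -
  let ?e = "(q * q) \<otimes> (q * q)"
  have "twist (q * q) = ?e * twist (1 + c) * twist (q * q)"
    by (simp add: twist_eqI[OF \<Psi>_one_plus_c] fls_tensor_mult qq_one_plus_c fls_tensor_one)
  also have "\<dots> = ?e * twist ((1 + c) * (q * q))"
    by (simp add: twist_mult mult.assoc)
  finally show ?thesis
    by (simp add: one_plus_c_qq twist_one)
qed

lemma commute_qq:
  assumes "y * c = c * y"
  shows "y * (q * q) = q * q * y"
proof -
  have "y * (q * q) = y * q * q" by (simp only: mult.assoc)
  also have "\<dots> = q * q * y" by (simp only: commute_c(4)[OF assms] mult.assoc)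
  finally show ?thesis .
qed

lemma p_qq: "p * (q * q) = q"
  by (simp add: pq flip: mult.assoc)

lemma twist_bbqq:
  assumes i: "i \<in> I" and j: "j \<in> I"
  shows "twist (b i * b j * (q * q)) = (b i * b j * (q * q)) \<otimes> 1 + b i \<otimes> (b j * q) + b j \<otimes> (b i * q)
    + (1 + c) \<otimes> (b i * b j * (q * q))"
proof -
  let ?e = "q * q"
  have 1: "p * p * ?e = 1" by (simp add: pp one_plus_c_qq)
  have 2: "b i * (1 + c) * ?e = b i" by (simp add: one_plus_c_qq mult.assoc)
  have 3: "p * b j * ?e = b j * q"
    by (simp add: commute_b(3)[OF j, symmetric] p_qq mult.assoc)
  have 4: "(1 + c) * b j * ?e = b j"
  proof -
    have "(1 + c) * b j = b j * (1 + c)" by (simp add: distrib_left distrib_right bc[OF j])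
    then show ?thesis by (simp add: one_plus_c_qq mult.assoc)
  qed
  have 5: "b i * p * ?e = b i * q" by (simp add: p_qq mult.assoc)
  have 6: "(1 + c) * (1 + c) * ?e = 1 + c" by (simp add: one_plus_c_qq mult.assoc)
  have "twist (b i * b j * ?e) = (b i \<otimes> p + (1 + c) \<otimes> b i) * (b j \<otimes> p + (1 + c) \<otimes> b j) * (?e \<otimes> ?e)"
    by (simp only: twist_mult twist_b[OF i] twist_b[OF j] twist_qq[unfolded twist_mult])
  also have "\<dots> = (b i * b j * ?e) \<otimes> (p * p * ?e) + (b i * (1 + c) * ?e) \<otimes> (p * b j * ?e)
     + ((1 + c) * b j * ?e) \<otimes> (b i * p * ?e) + ((1 + c) * (1 + c) * ?e) \<otimes> (b i * b j * ?e)"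
    by (rule fls_tensor_binomials_mult)
  finally show ?thesis
    by (simp only: 1 2 3 4 5 6)
qed

lemma K_invariant:
  assumes "h * X = X * h" "X * c = c * X"
  shows "K * (X \<otimes> 1 + 1 \<otimes> X) = (X \<otimes> 1 + 1 \<otimes> X) * K"
  using K_primitive[of X 0] assms by simp

lemma twist_raising:
  assumes i: "i \<in> I" and j: "j \<in> I"
    and aX: "\<And>l. l \<in> I \<Longrightarrow>
      a l * X = X * a l + ((if l = j then b i else 0) + (if l = i then b j else 0))"
    and bX: "\<And>l. l \<in> I \<Longrightarrow> b l * X = X * b l"
    and X: "X * c = c * X" "h * X = X * h" "\<Delta> X = X \<otimes> 1 + 1 \<otimes> X"
  defines "X' \<equiv> X - b i * b j * fls_exp (- \<sigma>)"
  shows "twist X' = X' \<otimes> 1 + 1 \<otimes> X'"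
proof -
  let ?P = "X \<otimes> 1 + 1 \<otimes> X" and ?Z = "b i \<otimes> (b j * q) + b j \<otimes> (b i * q)"
    and ?B = "b i * b j * (q * q)"
  have Tb: "T * (b m \<otimes> (b n * q)) = (b m \<otimes> (b n * q)) * T + c \<otimes> (b m * b n * (q * q))"
    if "m \<in> I" "n \<in> I" for m n
  proof -
    have "b n * q * c = c * (b n * q)"
      using bc[OF that(2)] commute_cc(4) by (metis mult.assoc)
    moreover have "b l * (b n * q) = b n * q * b l" if "l \<in> I" for l
      using bb[OF that \<open>n \<in> I\<close>] commute_b(4)[OF that] by (metis mult.assoc)
    ultimately show ?thesis
      using T_b[OF that(1), of "b n * q"] by (simp add: mult.assoc)
  qed
  have "fls_exp T * ?P = (?P + ?Z + c \<otimes> ?B) * fls_exp T"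
  proof (rule fls_exp_conjugate_quadratic[OF ord_T])
    have "T * (X \<otimes> 1) = (X \<otimes> 1) * T
        + (\<Sum>l\<in>I. ((if l = j then b i else 0) + (if l = i then b j else 0)) \<otimes> (b l * 1 * q)
            + (X * a l) \<otimes> (0 * q))"
      using aX by (intro T_commutator) auto
    also have "(\<Sum>l\<in>I. ((if l = j then b i else 0) + (if l = i then b j else 0)) \<otimes> (b l * 1 * q)
            + (X * a l) \<otimes> (0 * q)) = ?Z"
      using sum_two_deltas[OF finite_I i j, of "\<lambda>l x. x \<otimes> (b l * q)"]
      by (simp add: fls_tensor_add_left)
    finally show "T * ?P = ?P * T + ?Z"
      using T_commute[of X 1] X(1) bX by (simp add: distrib_left distrib_right)
    show "T * ?Z = ?Z * T + 2 *\<^sub>C (c \<otimes> ?B)"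
      using Tb[OF i j] Tb[OF j i] bb[OF i j] cscale_add_left[of 1 1 "c \<otimes> ?B"]
      by (simp add: distrib_left distrib_right cscale_one)
    have "b l * ?B = ?B * b l" if "l \<in> I" for l
      using bb[OF that i] bb[OF that j] commute_b(4)[OF that] by (metis mult.assoc)
    moreover have "?B * c = c * ?B"
      using bc[OF i] bc[OF j] commute_cc(4) by (metis mult.assoc)
    ultimately show "T * (c \<otimes> ?B) = (c \<otimes> ?B) * T"
      using ac by (intro T_commute) auto
  qed
  then have "\<Psi> * \<Delta> X = (?P + ?Z + c \<otimes> ?B) * \<Psi>"
    unfolding X(3) by (rule \<Psi>_trans[OF K_invariant[OF X(2,1)]])
  then have "twist X = ?P + ?Z + c \<otimes> ?B"
    by (rule twist_eqI)
  then show ?thesis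
    by (simp add: X'_def twist_diff twist_bbqq[OF i j] fls_tensor_diff fls_tensor_add_left flip: qq)
qed

lemma twist_lowering:
  assumes i: "i \<in> I" and j: "j \<in> I"
    and aX: "\<And>l. l \<in> I \<Longrightarrow> a l * X = X * a l"
    and bX: "\<And>l. l \<in> I \<Longrightarrow>
      b l * X = X * b l + ((if l = j then a i else 0) + (if l = i then a j else 0))"
    and X: "X * c = c * X" "h * X = X * h" "\<Delta> X = X \<otimes> 1 + 1 \<otimes> X"
  defines "X' \<equiv> X - a i * a j"
  shows "twist X' = X' \<otimes> 1 + 1 \<otimes> X'"
proof -
  let ?P = "X \<otimes> 1 + 1 \<otimes> X" and ?Z = "a j \<otimes> (a i * q) + a i \<otimes> (a j * q)"
    and ?W = "- ((a i * a j) \<otimes> (c * (q * q)))"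
  have Ta: "T * (a m \<otimes> (a n * q)) = (a m \<otimes> (a n * q)) * T - (a m * a n) \<otimes> (c * (q * q))"
    if "m \<in> I" "n \<in> I" for m n
    using T_a[OF that(2) aa[OF _ that(1)] commute_cc(4)[symmetric] commute_b(4)]
    by (simp add: mult.assoc)
  have "fls_exp T * ?P = (?P + ?Z + ?W) * fls_exp T"
  proof (rule fls_exp_conjugate_quadratic[OF ord_T])
    have "T * (1 \<otimes> X) = (1 \<otimes> X) * T
        + (\<Sum>l\<in>I. 0 \<otimes> (b l * X * q)
            + (1 * a l) \<otimes> (((if l = j then a i else 0) + (if l = i then a j else 0)) * q))"
      using bX X(1) by (intro T_commutator) auto
    also have "(\<Sum>l\<in>I. 0 \<otimes> (b l * X * q)
            + (1 * a l) \<otimes> (((if l = j then a i else 0) + (if l = i then a j else 0)) * q)) = ?Z"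
      using sum_two_deltas[OF finite_I i j, of "\<lambda>l x. a l \<otimes> (x * q)"]
      by (simp add: fls_tensor_add_right distrib_right)
    finally show "T * ?P = ?P * T + ?Z"
      using T_commute[of 1 X] aX by (simp add: distrib_left distrib_right)
    show "T * ?Z = ?Z * T + 2 *\<^sub>C ?W"
      using Ta[OF i j] Ta[OF j i] aa[OF i j] cscale_add_left[of 1 1 ?W]
      by (simp add: distrib_left distrib_right cscale_one)
    have "T * ((a i * a j) \<otimes> (c * (q * q))) = ((a i * a j) \<otimes> (c * (q * q))) * T"
    proof (rule T_commute)
      show "c * (q * q) * c = c * (c * (q * q))"
        using commute_cc(4) by (metis mult.assoc)
      fix l assume l: "l \<in> I"
      show "a l * (a i * a j) = a i * a j * a l"
        using aa[OF l i] aa[OF l j] by (metis mult.assoc)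
      show "b l * (c * (q * q)) = c * (q * q) * b l"
        using bc[OF l] commute_b(4)[OF l] by (metis mult.assoc)
    qed
    then show "T * ?W = ?W * T" by simp
  qed
  then have "\<Psi> * \<Delta> X = (?P + ?Z + ?W) * \<Psi>"
    unfolding X(3) by (rule \<Psi>_trans[OF K_invariant[OF X(2,1)]])
  then have 1: "twist X = ?P + ?Z + ?W"
    by (rule twist_eqI)
  have 2: "twist (a i * a j) = (a i * a j) \<otimes> (q * q) + ?Z + 1 \<otimes> (a i * a j)"
    using commute_a(4)[OF j] by (simp add: twist_mult twist_a i j distrib_left distrib_right fls_tensor_mult)
  have "c * (q * q) = 1 - q * q"
    using one_plus_c_qq by (simp add: distrib_right algebra_simps)
  then have 3: "?W = (a i * a j) \<otimes> (q * q) - (a i * a j) \<otimes> 1"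
    by (simp only: fls_tensor_diff minus_diff_eq)
  show ?thesis
    unfolding X'_def twist_diff 1 2 3 by (simp add: fls_tensor_diff algebra_simps)
qed

lemma twist_linear:
  assumes i: "i \<in> I" and j: "j \<in> I"
    and aX: "\<And>l. l \<in> I \<Longrightarrow> a l * X = X * a l + (if l = i then r *\<^sub>C a j else 0)"
    and bX: "\<And>l. l \<in> I \<Longrightarrow> b l * X = X * b l + (if l = j then - (r *\<^sub>C b i) else 0)"
    and X: "X * c = c * X" "h * X = X * h" "\<Delta> X = X \<otimes> 1 + 1 \<otimes> X"
  shows "twist X = X \<otimes> 1 + 1 \<otimes> X"
proof -
  let ?P = "X \<otimes> 1 + 1 \<otimes> X"
  have "T * (X \<otimes> 1) = (X \<otimes> 1) * T
      + (\<Sum>l\<in>I. (if l = i then r *\<^sub>C a j else 0) \<otimes> (b l * 1 * q) + (X * a l) \<otimes> (0 * q))"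
    using aX by (intro T_commutator) auto
  also have "(\<Sum>l\<in>I. (if l = i then r *\<^sub>C a j else 0) \<otimes> (b l * 1 * q) + (X * a l) \<otimes> (0 * q))
      = (\<Sum>l\<in>I. if l = i then r *\<^sub>C (a j \<otimes> (b l * q)) else 0)"
    by (rule sum.cong) (auto simp: fls_tensor_cscale)
  finally have 1: "T * (X \<otimes> 1) = (X \<otimes> 1) * T + r *\<^sub>C (a j \<otimes> (b i * q))"
    using i finite_I by simp
  have "T * (1 \<otimes> X) = (1 \<otimes> X) * T
      + (\<Sum>l\<in>I. 0 \<otimes> (b l * X * q) + (1 * a l) \<otimes> ((if l = j then - (r *\<^sub>C b i) else 0) * q))"
    using bX X(1) by (intro T_commutator) auto
  also have "(\<Sum>l\<in>I. 0 \<otimes> (b l * X * q) + (1 * a l) \<otimes> ((if l = j then - (r *\<^sub>C b i) else 0) * q))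
      = (\<Sum>l\<in>I. if l = j then - (r *\<^sub>C (a l \<otimes> (b i * q))) else 0)"
    by (rule sum.cong) (auto simp: fls_tensor_cscale fls_tensor_uminus cscale_mult_left)
  finally have 2: "T * (1 \<otimes> X) = (1 \<otimes> X) * T - r *\<^sub>C (a j \<otimes> (b i * q))"
    using j finite_I by simp
  have "fls_exp T * ?P = ?P * fls_exp T"
    by (rule fls_exp_commute[OF ord_T, symmetric]) (simp add: 1 2 distrib_left distrib_right)
  then have "\<Psi> * \<Delta> X = ?P * \<Psi>"
    unfolding X(3) by (rule \<Psi>_trans[OF K_invariant[OF X(2,1)]])
  then show ?thesis by (rule twist_eqI)
qed

definition "D = (\<Sum>i\<in>I. a i * b i) * (- ((1 / 2) *\<^sub>C g))"
definition "s = fls_exp D"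
definition "s' = fls_exp (- D)"

lemma ord_D: "fls_ord_ge 1 D"
proof -
  have "fls_ord_ge 1 (\<Sum>i\<in>I. a i * b i)"
    using fls_ord_ge_mult[OF ord_a ord_b] by (intro fls_ord_ge_sum) simp
  from fls_ord_ge_mult[OF this fls_ord_ge_uminus[OF fls_ord_ge_cscale[OF ord_g]]] show ?thesis
    by (simp add: D_def)
qed

lemma s_inverse: "s * s' = 1" "s' * s = 1"
  unfolding s_def s'_def by (rule fls_exp_minus[OF ord_D])+

lemma D_commutator:
  assumes x: "x * c = c * x"
    and \<alpha>: "\<And>l. l \<in> I \<Longrightarrow> a l * x = x * a l + \<alpha> l"
    and \<beta>: "\<And>l. l \<in> I \<Longrightarrow> b l * x = x * b l + \<beta> l"
  shows "D * x = x * D - (1 / 2) *\<^sub>C ((\<Sum>l\<in>I. a l * \<beta> l + \<alpha> l * b l) * g)"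
proof -
  let ?f = "- ((1 / 2) *\<^sub>C g)"
  have f: "?f * x = x * ?f"
    by (simp add: cscale_mult_left cscale_mult_right commute_c(2)[OF x])
  have "a l * b l * x = x * (a l * b l) + (a l * \<beta> l + \<alpha> l * b l)" if "l \<in> I" for l
  proof -
    have "a l * b l * x = a l * x * b l + a l * \<beta> l"
      by (simp add: \<beta>[OF that] mult.assoc distrib_left)
    then show ?thesis by (simp add: \<alpha>[OF that] distrib_right mult.assoc)
  qed
  then have "(\<Sum>l\<in>I. a l * b l) * x = x * (\<Sum>l\<in>I. a l * b l) + (\<Sum>l\<in>I. a l * \<beta> l + \<alpha> l * b l)"
    by (simp add: sum_distrib_left sum_distrib_right sum.distrib)
  moreover have "D * x = (\<Sum>l\<in>I. a l * b l) * x * ?f"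
    by (simp only: D_def mult.assoc f)
  ultimately show ?thesis
    by (simp add: D_def distrib_right mult.assoc cscale_mult_right cscale_add_right)
qed

lemma D_c: "D * c = c * D"
  using D_commutator[of c "\<lambda>_. 0" "\<lambda>_. 0"] ac bc by simp

lemmas D_commute = commute_c[OF D_c]

lemma D_b:
  assumes i: "i \<in> I"
  shows "D * b i = b i * D - (1 / 2) *\<^sub>C (\<sigma> * b i)"
proof -
  have "D * b i = b i * D - (1 / 2) *\<^sub>C ((\<Sum>l\<in>I. a l * 0 + (if l = i then c else 0) * b l) * g)"
    using ab[OF _ i] bb[OF _ i] bc[OF i] by (intro D_commutator) auto
  also have "(\<Sum>l\<in>I. a l * 0 + (if l = i then c else 0) * b l) = (\<Sum>l\<in>I. if l = i then c * b l else 0)"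
    by (rule sum.cong) auto
  also have "(\<Sum>l\<in>I. if l = i then c * b l else 0) * g = \<sigma> * b i"
    using i finite_I by (simp add: \<sigma>_eq mult.assoc commute_b(2))
  finally show ?thesis .
qed

lemma D_a:
  assumes i: "i \<in> I"
  shows "D * a i = a i * D + (1 / 2) *\<^sub>C (\<sigma> * a i)"
proof -
  have "b l * a i = a i * b l + (if l = i then - c else 0)" if "l \<in> I" for l
    using ab[OF i that] by auto
  then have "D * a i = a i * D - (1 / 2) *\<^sub>C ((\<Sum>l\<in>I. a l * (if l = i then - c else 0) + 0 * b l) * g)"
    using aa[OF _ i] ac[OF i] by (intro D_commutator) auto
  also have "(\<Sum>l\<in>I. a l * (if l = i then - c else 0) + 0 * b l) = (\<Sum>l\<in>I. if l = i then - (a l * c) else 0)"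
    by (rule sum.cong) auto
  also have "(\<Sum>l\<in>I. if l = i then - (a l * c) else 0) * g = - (\<sigma> * a i)"
    using i finite_I by (simp add: \<sigma>_eq mult.assoc commute_a(2) ac)
  finally show ?thesis by (simp add: cscale_minus_right)
qed

lemma D_product:
  assumes "D * x = x * D + r *\<^sub>C (\<sigma> * x)" "D * y = y * D + r *\<^sub>C (\<sigma> * y)" "x * c = c * x"
  shows "D * (x * y * g) = x * y * g * D + (2 * r) *\<^sub>C (\<sigma> * (x * y * g))"
proof -
  have "D * (x * y) = x * (D * y) + r *\<^sub>C (\<sigma> * (x * y))"
    using assms(1) by (simp add: distrib_right cscale_mult_left flip: mult.assoc)
  also have "x * (D * y) = x * y * D + r *\<^sub>C (\<sigma> * (x * y))"
    using commute_c(1)[OF assms(3)]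
    by (simp add: assms(2) distrib_left cscale_mult_right flip: mult.assoc)
  also have "x * y * D + r *\<^sub>C (\<sigma> * (x * y)) + r *\<^sub>C (\<sigma> * (x * y))
      = x * y * D + (2 * r) *\<^sub>C (\<sigma> * (x * y))"
    by (simp only: mult_2 cscale_add_left add.assoc)
  finally have "D * (x * y) * g = (x * y * D + (2 * r) *\<^sub>C (\<sigma> * (x * y))) * g"
    by simp
  then show ?thesis
    by (simp add: distrib_right cscale_mult_left mult.assoc D_commute(2))
qed

lemma half_double: "(1 / 2) *\<^sub>C ((x + x) * g) = x * g"
proof -
  have "(1 / 2) *\<^sub>C ((x + x) * g) = (1 / 2 + 1 / 2) *\<^sub>C (x * g)"
    by (simp only: distrib_right cscale_add_right cscale_add_left)
  then show ?thesis by (simp add: cscale_one)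
qed

lemma s_raising:
  assumes i: "i \<in> I" and j: "j \<in> I"
    and aX: "\<And>l. l \<in> I \<Longrightarrow>
      a l * X = X * a l + ((if l = j then b i else 0) + (if l = i then b j else 0))"
    and bX: "\<And>l. l \<in> I \<Longrightarrow> b l * X = X * b l" and X: "X * c = c * X"
  shows "s * X = (X - b i * b j * fls_exp (- \<sigma>)) * s"
proof -
  let ?w = "- (b i * b j * g)"
  have bbc: "b i * b j * c = c * (b i * b j)"
    using bc[OF i] bc[OF j] by (metis mult.assoc)
  have "D * X = X * D - (1 / 2) *\<^sub>C ((\<Sum>l\<in>I. a l * 0
      + ((if l = j then b i else 0) + (if l = i then b j else 0)) * b l) * g)"
    using aX bX X by (intro D_commutator) auto
  also have "(\<Sum>l\<in>I. a l * 0 + ((if l = j then b i else 0) + (if l = i then b j else 0)) * b l)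
      = b i * b j + b i * b j"
    using sum_two_deltas[OF finite_I i j, of "\<lambda>l x. x * b l"] bb[OF i j] by (simp add: distrib_right)
  finally have DX: "D * X = X * D + ?w"
    by (simp only: half_double add_uminus_conv_diff)
  have Dw: "D * ?w = ?w * D + - \<sigma> * ?w"
    using D_product[of "b i" "- 1 / 2" "b j"] D_b[OF i] D_b[OF j] bc[OF i]
    by (simp add: cscale_minus_left cscale_one)
  have "s * X = (X + fps_eval fps_expm1_over (- \<sigma>) * ?w) * s"
    unfolding s_def using DX Dw D_commute(1)
    by (intro fls_exp_conjugate_geometric[OF ord_D fls_ord_ge_uminus[OF ord_\<sigma>]]) simp_all
  also have "fps_eval fps_expm1_over (- \<sigma>) * ?w
      = - (fps_eval fps_expm1_over (- \<sigma>) * g * (b i * b j))"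
    by (simp add: mult.assoc flip: commute_c(2)[OF bbc])
  also have "\<dots> = - (fls_exp (- \<sigma>) * (b i * b j))"
    unfolding \<sigma>_def g_def by (simp only: fls_expm1_over_uminus_ln1p[OF ord_c])
  also have "\<dots> = - (b i * b j * fls_exp (- \<sigma>))"
    by (simp only: commute_qq[OF bbc, unfolded qq])
  finally show ?thesis by simp
qed

lemma s_lowering:
  assumes i: "i \<in> I" and j: "j \<in> I"
    and aX: "\<And>l. l \<in> I \<Longrightarrow> a l * X = X * a l"
    and bX: "\<And>l. l \<in> I \<Longrightarrow>
      b l * X = X * b l + ((if l = j then a i else 0) + (if l = i then a j else 0))"
    and X: "X * c = c * X"
  shows "s * X = (X - a i * a j) * s"
proof -
  let ?w = "- (a i * a j * g)"
  have aac: "a i * a j * c = c * (a i * a j)"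
    using ac[OF i] ac[OF j] by (metis mult.assoc)
  have "D * X = X * D - (1 / 2) *\<^sub>C ((\<Sum>l\<in>I. a l * ((if l = j then a i else 0) + (if l = i then a j else 0))
      + 0 * b l) * g)"
    using aX bX X by (intro D_commutator) auto
  also have "(\<Sum>l\<in>I. a l * ((if l = j then a i else 0) + (if l = i then a j else 0)) + 0 * b l)
      = a i * a j + a i * a j"
    using sum_two_deltas[OF finite_I i j, of "\<lambda>l x. a l * x"] aa[OF i j] by (simp add: distrib_left)
  finally have DX: "D * X = X * D + ?w"
    by (simp only: half_double add_uminus_conv_diff)
  have Dw: "D * ?w = ?w * D + \<sigma> * ?w"
    using D_product[of "a i" "1 / 2" "a j"] D_a[OF i] D_a[OF j] ac[OF i]
    by (simp add: cscale_one)
  have "s * X = (X + fps_eval fps_expm1_over \<sigma> * ?w) * s"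
    unfolding s_def using DX Dw D_commute(1)
    by (intro fls_exp_conjugate_geometric[OF ord_D ord_\<sigma>]) simp_all
  also have "fps_eval fps_expm1_over \<sigma> * ?w = - (fps_eval fps_expm1_over \<sigma> * g * (a i * a j))"
    by (simp add: mult.assoc flip: commute_c(2)[OF aac])
  also have "\<dots> = - (a i * a j)"
    unfolding \<sigma>_def g_def by (simp add: fls_expm1_over_ln1p[OF ord_c])
  finally show ?thesis by simp
qed

lemma s_linear:
  assumes i: "i \<in> I" and j: "j \<in> I"
    and aX: "\<And>l. l \<in> I \<Longrightarrow> a l * X = X * a l + (if l = i then r *\<^sub>C a j else 0)"
    and bX: "\<And>l. l \<in> I \<Longrightarrow> b l * X = X * b l + (if l = j then - (r *\<^sub>C b i) else 0)"
    and X: "X * c = c * X"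
  shows "s * X = X * s"
proof -
  have "D * X = X * D - (1 / 2) *\<^sub>C ((\<Sum>l\<in>I. a l * (if l = j then - (r *\<^sub>C b i) else 0)
      + (if l = i then r *\<^sub>C a j else 0) * b l) * g)"
    using aX bX X by (intro D_commutator) auto
  also have "(\<Sum>l\<in>I. a l * (if l = j then - (r *\<^sub>C b i) else 0) + (if l = i then r *\<^sub>C a j else 0) * b l)
      = (\<Sum>l\<in>I. (if l = j then - (r *\<^sub>C (a l * b i)) else 0) + (if l = i then r *\<^sub>C (a j * b l) else 0))"
    by (rule sum.cong) (auto simp: cscale_mult_left cscale_mult_right)
  also have "\<dots> = 0"
    using i j finite_I by (simp add: sum.distrib)
  finally show ?thesis
    unfolding s_def by (intro fls_exp_commute[OF ord_D, symmetric]) simp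
qed

definition "\<Omega> = (s' \<otimes> s') * twist s"
definition "\<Omega>' = twist s' * (s \<otimes> s)"

lemma twist_s: "twist s * twist s' = 1" "twist s' * twist s = 1"
  by (simp_all add: s_inverse twist_one flip: twist_mult)

lemma \<Omega>_inverse: "\<Omega> * \<Omega>' = 1" "\<Omega>' * \<Omega> = 1"
proof -
  have ss: "(s' \<otimes> s') * (s \<otimes> s) = 1" "(s \<otimes> s) * (s' \<otimes> s') = 1"
    by (simp_all add: fls_tensor_mult s_inverse fls_tensor_one)
  have "\<Omega> * \<Omega>' = (s' \<otimes> s') * (twist s * twist s') * (s \<otimes> s)"
    by (simp add: \<Omega>_def \<Omega>'_def mult.assoc)
  then show "\<Omega> * \<Omega>' = 1" by (simp add: twist_s ss)
  have "\<Omega>' * \<Omega> = twist s' * ((s \<otimes> s) * (s' \<otimes> s')) * twist s"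
    by (simp add: \<Omega>_def \<Omega>'_def mult.assoc)
  then show "\<Omega>' * \<Omega> = 1" by (simp add: twist_s ss)
qed

lemma coboundary_primitive:
  assumes "s * X = X' * s" "twist X' = X' \<otimes> 1 + 1 \<otimes> X'"
  shows "\<Omega> * twist X * \<Omega>' = X \<otimes> 1 + 1 \<otimes> X"
proof -
  have "s * X * s' = X'"
    unfolding assms(1) by (simp add: mult.assoc s_inverse)
  moreover have "\<Omega> * twist X * \<Omega>' = (s' \<otimes> s') * twist (s * X * s') * (s \<otimes> s)"
    by (simp add: \<Omega>_def \<Omega>'_def twist_mult mult.assoc)
  ultimately have "\<Omega> * twist X * \<Omega>' = (s' \<otimes> s') * (X' \<otimes> 1 + 1 \<otimes> X') * (s \<otimes> s)"
    by (simp add: assms(2))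
  also have "\<dots> = (s' * X' * s) \<otimes> (s' * s) + (s' * s) \<otimes> (s' * X' * s)"
    by (simp add: distrib_left distrib_right fls_tensor_mult)
  also have "s' * X' * s = X"
    using arg_cong[OF assms(1), of "\<lambda>x. s' * x"] by (simp add: s_inverse flip: mult.assoc)
  finally show ?thesis by (simp add: s_inverse)
qed

end

section \<open>Brackets of the symplectic Lie algebra\<close>

lemma mat_unit_mult:
  fixes a :: "'l::finite" and b c :: "'m::finite" and d :: "'r::finite"
  shows "mat_unit a b ** mat_unit c d = (if b = c then mat_unit a d else 0)"
proof -
  have "(\<Sum>k\<in>UNIV. (if i = a \<and> k = b then 1 else 0) * (if k = c \<and> j = d then 1 else 0 :: complex))
      = (\<Sum>k\<in>UNIV. if k = b then (if b = c \<and> i = a \<and> j = d then 1 else 0) else 0)" for i j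
    by (rule sum.cong) auto
  then show ?thesis
    by (auto simp: matrix_matrix_mult_def mat_unit_def vec_eq_iff)
qed

lemma matrix_mult_distrib:
  fixes X Y Z :: "complex^'n::finite^'n"
  shows "(X + Y) ** Z = X ** Z + Y ** Z" "Z ** (X + Y) = Z ** X + Z ** Y"
    "(X - Y) ** Z = X ** Z - Y ** Z" "Z ** (X - Y) = Z ** X - Z ** Y"
  by (simp_all add: matrix_matrix_mult_def vec_eq_iff algebra_simps sum.distrib sum_subtractf)

lemmas sp_bracket_simps = matrix_mult_distrib mat_unit_mult

lemma bracket_E_minus_E_minus:
  "bracket (sp_E_minus i j) (sp_E_minus l m)
    = (if j = l then sp_E_minus i m else 0) - (if i = m then sp_E_minus l j else 0)"
  by transfer (auto simp: sp_bracket_simps)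

lemma bracket_E_minus_E_plus:
  "bracket (sp_E_minus i j) (sp_E_plus l m)
    = (if j = l then sp_E_plus i m else 0) + (if j = m then sp_E_plus l i else 0)"
  by transfer (auto simp: sp_bracket_simps)

lemma bracket_E_plus_E_plus: "bracket (sp_E_plus i j) (sp_E_plus l m) = 0"
  by transfer (simp add: sp_bracket_simps)

lemma bracket_E_minus_F_plus:
  "bracket (sp_E_minus i j) (sp_F_plus l m)
    = - (if i = l then sp_F_plus j m else 0) - (if i = m then sp_F_plus l j else 0)"
  by transfer (auto simp: sp_bracket_simps)

lemma bracket_E_plus_F_plus:
  "bracket (sp_E_plus i j) (sp_F_plus l m)
    = (if j = l then sp_E_minus i m else 0) + (if j = m then sp_E_minus i l else 0)
      + (if i = l then sp_E_minus j m else 0) + (if i = m then sp_E_minus j l else 0)"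
  by transfer (auto simp: sp_bracket_simps)

lemma sp_F_minus_eq: "sp_F_minus i j = sp_E_minus j i"
  by transfer simp

lemma sp_H_eq: "sp_H i = (1 / 2) *\<^sub>C sp_E_minus i i"
  by transfer simp

definition uea_fls :: "int \<Rightarrow> 'g::complex_lie_algebra \<Rightarrow> 'g uea fls"
  where "uea_fls d x = fls_shift (- d) (fls_const (uea_incl x))"

lemma uea_fls_nth: "fls_nth (uea_fls d x) n = (if n = d then uea_incl x else 0)"
  by (simp add: uea_fls_def)

lemma uea_incl_zero [simp]: "uea_incl 0 = 0"
  using uea_incl_add[of 0 0] by simp

lemma uea_fls_0 [simp]: "uea_fls d 0 = 0"
  by (simp add: fls_eq_iff uea_fls_nth)

lemma uea_fls_add: "uea_fls d (x + y) = uea_fls d x + uea_fls d y"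
  by (simp add: fls_eq_iff uea_fls_nth uea_incl_add)

lemma uea_fls_cscale: "uea_fls d (c *\<^sub>C x) = c *\<^sub>C uea_fls d x"
  by (simp add: fls_eq_iff uea_fls_nth uea_incl_cscale)

lemma uea_fls_commutator:
  "uea_fls d x * uea_fls e y = uea_fls e y * uea_fls d x + uea_fls (d + e) (bracket x y)"
  by (simp add: uea_fls_def fls_shifted_times_simps uea_incl_bracket fls_eq_iff add_ac)

lemma fls_ord_ge_uea_fls: "fls_ord_ge d (uea_fls d x)"
  by (simp add: fls_ord_ge_def uea_fls_nth)

lemma fls_coprod_uea_fls: "fls_coprod (uea_fls d x) = uea_fls d x \<otimes> 1 + 1 \<otimes> uea_fls d x"
  by (rule fls_eqI) (simp add: fls_coprod_def fls_map_nth fls_tensor_nth uea_fls_nth coprod_incl)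

lemma generators_conv_uea_fls:
  "E_minus i j = uea_fls 0 (sp_E_minus i j)" "E_plus i j = uea_fls 1 (sp_E_plus i j)"
  "F_minus i j = uea_fls 0 (sp_E_minus j i)" "F_plus i j = uea_fls (- 1) (sp_F_plus i j)"
  "H_diag i = (1 / 2) *\<^sub>C uea_fls 0 (sp_E_minus i i)"
  by (simp_all add: E_minus_def E_plus_def F_minus_def F_plus_def H_diag_def uea_fls_def
      sp_F_minus_eq fls_X_times_conv_shift fls_X_inv_times_conv_shift)
    (simp add: sp_H_eq uea_incl_cscale fls_eq_iff)

lemma sp_E_plus_commute: "sp_E_plus i j = sp_E_plus j i"
  by transfer (simp add: add.commute)

lemma heisenberg_twist_sp:
  fixes k :: "'n::{finite,linorder}"
  shows "heisenberg_twist {k<..} (E_minus k) (E_plus k) (E_plus k k) (H_diag k) fls_coprod"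
proof
  fix i j assume "i \<in> {k<..}" "j \<in> {k<..}"
  then have k: "i \<noteq> k" "j \<noteq> k" by auto
  show "E_minus k i * E_minus k j = E_minus k j * E_minus k i"
    using uea_fls_commutator[of 0 "sp_E_minus k i" 0 "sp_E_minus k j"] k
    by (simp add: generators_conv_uea_fls bracket_E_minus_E_minus)
  show "E_plus k i * E_plus k j = E_plus k j * E_plus k i"
    using uea_fls_commutator[of 1 "sp_E_plus k i" 1 "sp_E_plus k j"]
    by (simp add: generators_conv_uea_fls bracket_E_plus_E_plus)
  show "E_minus k i * E_plus k j = E_plus k j * E_minus k i + (if i = j then E_plus k k else 0)"
    using uea_fls_commutator[of 0 "sp_E_minus k i" 1 "sp_E_plus k j"] k
    by (simp add: generators_conv_uea_fls bracket_E_minus_E_plus)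
next
  fix i assume "i \<in> {k<..}"
  then have k: "i \<noteq> k" by auto
  show "E_minus k i * E_plus k k = E_plus k k * E_minus k i"
    using uea_fls_commutator[of 0 "sp_E_minus k i" 1 "sp_E_plus k k"] k
    by (simp add: generators_conv_uea_fls bracket_E_minus_E_plus)
  show "E_plus k i * E_plus k k = E_plus k k * E_plus k i"
    using uea_fls_commutator[of 1 "sp_E_plus k i" 1 "sp_E_plus k k"]
    by (simp add: generators_conv_uea_fls bracket_E_plus_E_plus)
  show "H_diag k * E_minus k i = E_minus k i * H_diag k + (1 / 2) *\<^sub>C E_minus k i"
    using uea_fls_commutator[of 0 "sp_E_minus k k" 0 "sp_E_minus k i"] k
    by (simp add: generators_conv_uea_fls bracket_E_minus_E_minus cscale_mult_left
        cscale_mult_right flip: cscale_add_right)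
  show "H_diag k * E_plus k i = E_plus k i * H_diag k + (1 / 2) *\<^sub>C E_plus k i"
    using uea_fls_commutator[of 0 "sp_E_minus k k" 1 "sp_E_plus k i"] k
    by (simp add: generators_conv_uea_fls bracket_E_minus_E_plus cscale_mult_left
        cscale_mult_right flip: cscale_add_right)
  show "fls_ord_ge 0 (E_minus k i)" "fls_ord_ge 1 (E_plus k i)"
    by (simp_all only: generators_conv_uea_fls fls_ord_ge_uea_fls)
  show "fls_coprod (E_minus k i) = E_minus k i \<otimes> 1 + 1 \<otimes> E_minus k i"
    "fls_coprod (E_plus k i) = E_plus k i \<otimes> 1 + 1 \<otimes> E_plus k i"
    by (simp_all only: generators_conv_uea_fls fls_coprod_uea_fls)
next
  have "(1 / 2 :: complex) *\<^sub>C (x + x) = x" for x :: "'n sp uea fls"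
    by (simp add: cscale_add_right cscale_one flip: cscale_add_left)
  then show "H_diag k * E_plus k k = E_plus k k * H_diag k + E_plus k k"
    using uea_fls_commutator[of 0 "sp_E_minus k k" 1 "sp_E_plus k k"]
    by (simp add: generators_conv_uea_fls bracket_E_minus_E_plus cscale_mult_left
        cscale_mult_right uea_fls_add cscale_add_right)
  show "fls_ord_ge 1 (E_plus k k)" "fls_ord_ge 0 (H_diag k)"
    by (simp_all add: generators_conv_uea_fls fls_ord_ge_uea_fls fls_ord_ge_cscale)
  show "fls_coprod (E_plus k k) = E_plus k k \<otimes> 1 + 1 \<otimes> E_plus k k"
    by (simp only: generators_conv_uea_fls fls_coprod_uea_fls)
qed (simp_all add: fls_coprod_add fls_coprod_mult fls_coprod_one)

theorem mainTheorem4: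
  fixes k :: "'n::{finite,linorder}"
  shows "(\<forall>X\<in>generators_above k.
            twisted_coprod k (transformed_gen k X)
              = transformed_gen k X \<otimes> 1 + 1 \<otimes> transformed_gen k X)
       \<and> (\<forall>X\<in>generators_above k.
            coboundary_twist k * twisted_coprod k (gen_elem X) * mult_inv (coboundary_twist k)
              = gen_elem X \<otimes> 1 + 1 \<otimes> gen_elem X)"
proof -
  interpret heisenberg_twist "{k<..}" "E_minus k" "E_plus k" "E_plus k k" "H_diag k" fls_coprod
    by (rule heisenberg_twist_sp)
  have sigma: "sigma k = \<sigma>"
    by (simp add: sigma_def \<sigma>_def)
  have "extended_twist k = \<Psi>"
    using prod_list_exp[of "sorted_list_of_set {k<..}"]
    by (simp add: extended_twist_def \<Psi>_def K_def T_def sigma q_def)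
  moreover have "mult_inv \<Psi> = \<Psi>'"
    unfolding \<Psi>'_def by (rule mult_inv_eqI) (rule \<Psi>_inverse)+
  ultimately have twist: "twisted_coprod k x = twist x" for x
    by (simp add: twisted_coprod_def twist_def)
  have "s_elem k = s"
    by (simp add: s_elem_def s_def D_def g_def)
  moreover have "mult_inv s = s'"
    by (rule mult_inv_eqI) (rule s_inverse)+
  ultimately have cob: "coboundary_twist k = \<Omega>"
    by (simp add: coboundary_twist_def \<Omega>_def twist)
  have inv: "mult_inv \<Omega> = \<Omega>'"
    by (rule mult_inv_eqI) (rule \<Omega>_inverse)+
  have gl: "s * X = X * s \<and> twist X = X \<otimes> 1 + 1 \<otimes> X"
    if ij: "k < i" "k < j" and X_def: "X = r *\<^sub>C E_minus i j" for X i j r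
  proof -
    from ij have k: "k \<noteq> i" "k \<noteq> j" "i \<noteq> k" "j \<noteq> k" by auto
    have aX: "E_minus k l * X = X * E_minus k l + (if l = i then r *\<^sub>C E_minus k j else 0)"
      if "l \<in> {k<..}" for l
      using uea_fls_commutator[of 0 "sp_E_minus k l" 0 "sp_E_minus i j"] k that
      by (auto simp: X_def generators_conv_uea_fls bracket_E_minus_E_minus cscale_mult_left
          cscale_mult_right simp flip: cscale_add_right)
    have bX: "E_plus k l * X = X * E_plus k l + (if l = j then - (r *\<^sub>C E_plus k i) else 0)"
      if "l \<in> {k<..}" for l
      using uea_fls_commutator[of 0 "sp_E_minus i j" 1 "sp_E_plus k l"] k that
      by (auto simp: X_def generators_conv_uea_fls bracket_E_minus_E_plus cscale_mult_left
          cscale_mult_right cscale_add_right)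
    have cX: "X * E_plus k k = E_plus k k * X"
      using uea_fls_commutator[of 0 "sp_E_minus i j" 1 "sp_E_plus k k"] k
      by (simp add: X_def generators_conv_uea_fls bracket_E_minus_E_plus cscale_mult_left
          cscale_mult_right)
    have hX: "H_diag k * X = X * H_diag k"
      using uea_fls_commutator[of 0 "sp_E_minus k k" 0 "sp_E_minus i j"] k
      by (simp add: X_def generators_conv_uea_fls bracket_E_minus_E_minus cscale_mult_left
          cscale_mult_right cscale_cscale mult.commute)
    have "X = uea_fls 0 (r *\<^sub>C sp_E_minus i j)"
      by (simp add: X_def generators_conv_uea_fls uea_fls_cscale)
    then have "fls_coprod X = X \<otimes> 1 + 1 \<otimes> X"
      by (simp only: fls_coprod_uea_fls)
    then show ?thesis
      using s_linear[OF _ _ aX bX cX] twist_linear[OF _ _ aX bX cX hX] ij by simp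
  qed
  have main: "s * gen_elem X = transformed_gen k X * s
      \<and> twist (transformed_gen k X) = transformed_gen k X \<otimes> 1 + 1 \<otimes> transformed_gen k X"
    if "X \<in> generators_above k" for X
  proof -
    show ?thesis
    proof (cases X)
      case (GEminus i j)
      then have "k < i" "k < j" using that by (auto simp: generators_above_def)
      from gl[OF this cscale_one[symmetric]] show ?thesis by (simp add: GEminus)
    next
      case (GFminus i j)
      then have "k < j" "k < i" using that by (auto simp: generators_above_def)
      from gl[OF this cscale_one[symmetric]] show ?thesis
        by (simp add: GFminus generators_conv_uea_fls)
    next
      case (GH i)
      then have "k < i" using that by (auto simp: generators_above_def)
      from gl[OF this this refl, of "1 / 2"] show ?thesis
        by (simp add: GH generators_conv_uea_fls)
    next
      case (GEplus i j)
      then have ij: "i \<in> {k<..}" "j \<in> {k<..}" using that by (auto simp: generators_above_def)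
      then have k: "k \<noteq> i" "k \<noteq> j" by auto
      let ?X = "E_plus i j"
      have aX: "E_minus k l * ?X = ?X * E_minus k l
          + ((if l = j then E_plus k i else 0) + (if l = i then E_plus k j else 0))" for l
        using uea_fls_commutator[of 0 "sp_E_minus k l" 1 "sp_E_plus i j"]
        by (auto simp: generators_conv_uea_fls bracket_E_minus_E_plus uea_fls_add
            sp_E_plus_commute[of i k])
      have bX: "E_plus k l * ?X = ?X * E_plus k l" for l
        using uea_fls_commutator[of 1 "sp_E_plus k l" 1 "sp_E_plus i j"]
        by (simp add: generators_conv_uea_fls bracket_E_plus_E_plus)
      have hX: "H_diag k * ?X = ?X * H_diag k"
        using uea_fls_commutator[of 0 "sp_E_minus k k" 1 "sp_E_plus i j"] k
        by (simp add: generators_conv_uea_fls bracket_E_minus_E_plus cscale_mult_left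
            cscale_mult_right)
      have "fls_coprod ?X = ?X \<otimes> 1 + 1 \<otimes> ?X"
        by (simp only: generators_conv_uea_fls fls_coprod_uea_fls)
      then show ?thesis
        using s_raising[OF ij aX bX bX[of k, symmetric]]
          twist_raising[OF ij aX bX bX[of k, symmetric] hX]
        by (simp add: GEplus sigma)
    next
      case (GFplus i j)
      then have ij: "i \<in> {k<..}" "j \<in> {k<..}" using that by (auto simp: generators_above_def)
      then have k: "k \<noteq> i" "k \<noteq> j" by auto
      let ?X = "F_plus i j"
      have aX: "E_minus k l * ?X = ?X * E_minus k l" for l
        using uea_fls_commutator[of 0 "sp_E_minus k l" "- 1" "sp_F_plus i j"] k
        by (simp add: generators_conv_uea_fls bracket_E_minus_F_plus)
      have bX: "E_plus k l * ?X = ?X * E_plus k l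
          + ((if l = j then E_minus k i else 0) + (if l = i then E_minus k j else 0))" for l
        using uea_fls_commutator[of 1 "sp_E_plus k l" "- 1" "sp_F_plus i j"] k
        by (auto simp: generators_conv_uea_fls bracket_E_plus_F_plus uea_fls_add)
      have hX: "H_diag k * ?X = ?X * H_diag k"
        using uea_fls_commutator[of 0 "sp_E_minus k k" "- 1" "sp_F_plus i j"] k
        by (simp add: generators_conv_uea_fls bracket_E_minus_F_plus cscale_mult_left
            cscale_mult_right)
      have "fls_coprod ?X = ?X \<otimes> 1 + 1 \<otimes> ?X"
        by (simp only: generators_conv_uea_fls fls_coprod_uea_fls)
      moreover have "?X * E_plus k k = E_plus k k * ?X"
        using bX[of k] k by simp
      ultimately show ?thesis
        using s_lowering[OF ij aX bX] twist_lowering[OF ij aX bX _ hX]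
        by (simp add: GFplus)
    qed
  qed
  show ?thesis
    using main coboundary_primitive by (simp add: twist cob inv)
qed

end
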